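(* Assume: (i) the samples in $\Xi=\{(x^s,y^s)\}_{s=1}^n$ of $(X,Y)$ are independent and identically distributed; (ii) the support $\mathcal X\subseteq\mathbb R^p$ of $X$ is compact with $\bar X=\max_{x\in\mathcal X}\|x\|_\infty$; (iii) there are $L_\varphi>0$, $C_\varphi>0$ and $z_0\in\mathbb R^d$ such that for every $y\in\mathcal Y$ the function $\varphi(\cdot,y)$ is $L_\varphi$-Lipschitz continuous on $\mathbb R^d$ and $|\varphi(z_0,y)|\le C_\varphi$; (iv) there is a Lipschitz continuous function $f^*:\mathcal X\to\mathbb R^d$ that minimizes $R$ over $\mathcal F$, and $L_z,M_z>0$ are such that $f^*\in\mathcal F_{L_z,M_z}$. Let $\mu\ge\max\{\tfrac12L_zK^{1/p},\ \tfrac14pL_z\bar XK^{1/p}+\tfrac12M_z\}$ and $M_{p,d}(\mu)=C_\varphi+L_\varphi\big(2\sqrt d\,\mu(p\bar X+1)+\|z_0\|\big)$. Then with probability at least $1-\delta$ over the draw of $\Xi$, $$\begin{aligned}R(f^*_{\Xi,\mathcal H_\mu^K})\le{}&\inf_{f\in\mathcal F}R(f)+2d^{1/2}(p^{1/2}+3)p^{1/2}L_\varphi L_z\bar XK^{-1/p}+\frac{16\mu L_\varphi\sqrt{2dK(p+1)(p\bar X^2+1)}}{n}\\&+4M_{p,d}(\mu)\sqrt{\frac{2dK(p+1)\log n}{n}}+2\sqrt2\,M_{p,d}(\mu)\sqrt{\frac{\log(2/\delta)}{n}}.\end{aligned}$$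
   Context: $X$ is a random vector with support $\mathcal X\subseteq\mathbb R^p$, $Y$ a random variable with support $\mathcal Y$, $\varphi:\mathbb R^d\times\mathcal Y\to\mathbb R$ a cost function; $\mathcal F$ is the set of all measurable $f:\mathcal X\to\mathbb R^d$; $R(f)=\mathbb E_{X,Y}[\varphi(f(X),Y)]$; and $\widehat R_\Xi(f)=\frac1n\sum_{s=1}^n\varphi(f(x^s),y^s)$. $\|\cdot\|$ is the Euclidean norm and $[K]=\{1,\dots,K\}$. For $f:\mathcal X\to\mathbb R^d$, $\|f\|_\infty=\sup_{x\in\mathcal X}\max_{\iota\in[d]}|f_\iota(x)|$; for $L,M>0$, $\mathcal F_{L,M}=\{f:\mathcal X\to\mathbb R^d\mid\|f\|_\infty\le M,\ f\text{ is }L\text{-Lipschitz}\}$. The class $\mathcal H_\mu^K$ consists of all $f=(f_\iota(\cdot,\theta_\iota))_{\iota=1}^d$ with $f_\iota(x,\theta_\iota)=\max_{k\in[K]}\{(\alpha_\iota^k)^\top x+a_\iota^k\}-\max_{k\in[K]}\{(\beta_\iota^k)^\top x+b_\iota^k\}$, $\theta_\iota=(\alpha_\iota^k,a_\iota^k,\beta_\iota^k,b_\iota^k)_{k=1}^K\in\mathbb R^{2K(p+1)}$, $\|\theta_\iota\|_\infty\le\mu$ for all $\iota\in[d]$. $f^*_{\Xi,\mathcal H_\mu^K}$ denotes an optimal solution of $\min_{f\in\mathcal H_\mu^K}\widehat R_\Xi(f)$. *)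

theory Defs
  imports "HOL-Probability.Probability"
begin

text \<open>The support of a random variable: the smallest closed set that contains its value
  almost surely.\<close>

definition rv_support :: "'w measure \<Rightarrow> ('w \<Rightarrow> 'b::topological_space) \<Rightarrow> 'b set" where
  "rv_support M Z = \<Inter>{C. closed C \<and> (AE w in M. Z w \<in> C)}"

text \<open>The expectation with values in the extended reals. The Bochner integral would assign the
  value 0 to a loss of infinite expectation. If the positive and the negative part both have
  infinite integral, the value is \<open>\<infinity> - \<infinity> = \<infinity>\<close>, the usual convention in
  stochastic minimization.\<close>

definition ext_expectation :: "'w measure \<Rightarrow> ('w \<Rightarrow> real) \<Rightarrow> ereal" where
  "ext_expectation M g =
     enn2ereal (\<integral>\<^sup>+ w. ennreal (g w) \<partial>M) - enn2ereal (\<integral>\<^sup>+ w. ennreal (- g w) \<partial>M)"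

text \<open>Functions on \<open>S \<subseteq> \<real>\<^sup>p\<close> are represented by total functions of which only the values on
  \<open>S\<close> are constrained. When \<open>S\<close> is the support of \<open>X\<close>, these are the only values that affect
  the risk, because \<open>X \<in> S\<close> almost surely and \<open>nn_integral\<close> is invariant under arbitrary
  changes on a null set (also non-measurable ones).\<close>

definition predictors :: "(real^'p) set \<Rightarrow> (real^'p \<Rightarrow> real^'d) set" where
  "predictors S = restrict_space borel S \<rightarrow>\<^sub>M borel"

definition risk ::
  "(real^'d \<Rightarrow> 'y \<Rightarrow> real) \<Rightarrow> 'w measure \<Rightarrow> ('w \<Rightarrow> real^'p) \<Rightarrow> ('w \<Rightarrow> 'y) \<Rightarrow>
   (real^'p \<Rightarrow> real^'d) \<Rightarrow> ereal" where
  "risk \<phi> M X Y f = ext_expectation M (\<lambda>w. \<phi> (f (X w)) (Y w))"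

definition empirical_risk ::
  "(real^'d \<Rightarrow> 'y \<Rightarrow> real) \<Rightarrow> nat \<Rightarrow> (nat \<Rightarrow> (real^'p) \<times> 'y) \<Rightarrow> (real^'p \<Rightarrow> real^'d) \<Rightarrow> real" where
  "empirical_risk \<phi> n \<xi> f = (1 / real n) * (\<Sum>s=1..n. \<phi> (f (fst (\<xi> s))) (snd (\<xi> s)))"

text \<open>The supremum norm of \<open>f\<close> on \<open>S\<close>, extended-real valued since \<open>f\<close> may be unbounded;
  \<open>infnorm\<close> is the maximum of the absolute values of the coordinates.\<close>

definition sup_norm_on :: "(real^'p) set \<Rightarrow> (real^'p \<Rightarrow> real^'d) \<Rightarrow> ereal" where
  "sup_norm_on S f = (SUP x\<in>S. ereal (infnorm (f x)))"

definition lipschitz_class ::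
  "(real^'p) set \<Rightarrow> real \<Rightarrow> real \<Rightarrow> (real^'p \<Rightarrow> real^'d) set" where
  "lipschitz_class S L B = {f. sup_norm_on S f \<le> ereal B \<and> L-lipschitz_on S f}"

text \<open>A parameter of a single output coordinate consists of the blocks
  \<open>(\<alpha>\<^sup>k, a\<^sup>k, \<beta>\<^sup>k, b\<^sup>k)\<close>, \<open>k \<in> {1..K}\<close>, so it lies in a space of dimension \<open>2K(p+1)\<close>.\<close>

type_synonym 'p block = "(real^'p) \<times> real \<times> (real^'p) \<times> real"

definition dc_fun :: "nat \<Rightarrow> (nat \<Rightarrow> 'p::finite block) \<Rightarrow> real^'p \<Rightarrow> real" where
  "dc_fun K \<theta> x =
     Max ((\<lambda>k. case \<theta> k of (\<alpha>, a, \<beta>, b) \<Rightarrow> \<alpha> \<bullet> x + a) ` {1..K}) -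
     Max ((\<lambda>k. case \<theta> k of (\<alpha>, a, \<beta>, b) \<Rightarrow> \<beta> \<bullet> x + b) ` {1..K})"

definition param_norm :: "nat \<Rightarrow> (nat \<Rightarrow> 'p::finite block) \<Rightarrow> real" where
  "param_norm K \<theta> = Max ((\<lambda>k. infnorm (\<theta> k)) ` {1..K})"

definition dc_class :: "nat \<Rightarrow> real \<Rightarrow> (real^'p \<Rightarrow> real^'d) set" where
  "dc_class K \<mu> =
     {f. \<exists>\<theta> :: 'd \<Rightarrow> nat \<Rightarrow> 'p block.
           (\<forall>\<iota>. param_norm K (\<theta> \<iota>) \<le> \<mu>) \<and> f = (\<lambda>x. \<chi> \<iota>. dc_fun K (\<theta> \<iota>) x)}"

end

theory Submission
  imports Defs
begin

text \<open>The excess risk of the empirical minimizer splits into an approximation error of the class and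
  a statistical error.

  Approximation: a Lipschitz function \<open>f\<close> of one output coordinate is the sum of \<open>f / 2\<close> and
  \<open>- (- f / 2)\<close>. Both halves are approximated by a maximum of downward paraboloids of equal
  curvature whose apices lie over the nodes of a grid of at most \<open>K\<close> points. In the
  difference of the two maxima the quadratic terms in \<open>x\<close> cancel, and a difference of two maxima of
  \<open>K\<close> affine functions remains (\<open>dc_fun_approximates_lipschitz\<close>). The curvature is taken
  proportional to \<open>K powr (1/p)\<close>; this keeps the parameters below \<open>\<mu>\<close> and makes all
  contributions to the error of the order \<open>K powr (- 1/p)\<close>.

  Statistics: the parameters of the class form a box of dimension \<open>2 d K (p + 1)\<close>, and the loss is a
  Lipschitz function of them. Dividing every side of the box into \<open>n\<close> pieces gives a net of at most
  \<open>n ^ (2 d K (p + 1))\<close> functions (\<open>dc_class_finite_net\<close>) with a rounding error of order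
  \<open>1 / n\<close>. Hoeffding's inequality and a union bound control \<open>risk - empirical risk\<close> on the
  net, with half of the failure probability. The opposite deviation matters only for the one
  function that approximates the target, so a single application of Hoeffding's inequality, with
  the other half, suffices there (\<open>erm_excess_risk_bound\<close>). The logarithm of the size of the
  net is the source of the term with \<open>ln n\<close>.\<close>

section \<open>Covering boxes in the maximum norm\<close>

lemma infnorm_leI:
  fixes x :: "'a::euclidean_space"
  assumes "\<And>b. b \<in> Basis \<Longrightarrow> \<bar>x \<bullet> b\<bar> \<le> r"
  shows "infnorm x \<le> r"
  using assms unfolding infnorm_Max by (subst Max_le_iff) auto

lemma norm_le_sqrt_card:
  fixes x :: "real^'n"
  assumes "\<And>i. \<bar>x $ i\<bar> \<le> r"
  shows "norm x \<le> sqrt CARD('n) * r"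
proof -
  have "infnorm x \<le> r" using assms by (auto intro!: infnorm_leI simp: Basis_vec_def inner_axis)
  then have "sqrt CARD('n) * infnorm x \<le> sqrt CARD('n) * r" by (intro mult_left_mono) auto
  moreover have "norm x \<le> sqrt CARD('n) * infnorm x" using norm_le_infnorm[of x] by simp
  ultimately show ?thesis by (rule order_trans[rotated])
qed

lemma interval_cover:
  fixes r t :: real
  assumes "N \<ge> 1" "\<bar>t\<bar> \<le> r"
  shows "\<exists>j<N. \<bar>t - (- r + (2 * real j + 1) * r / real N)\<bar> \<le> r / real N"
proof (cases "r = 0")
  case True
  then show ?thesis using assms by (intro exI[of _ 0]) auto
next
  case False
  with assms have r: "r > 0" by linarith
  \<comment> \<open>The number \<open>u\<close> is the position of \<open>t\<close> in units of the length of a piece. The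
    minimum assigns the right end point \<open>t = r\<close> to the last piece.\<close>
  define u where "u = (t + r) * real N / (2 * r)"
  have N: "real N > 0" using assms by simp
  have u: "0 \<le> u" "u \<le> real N"
    using assms r N by (auto simp: u_def divide_simps mult.commute intro!: mult_left_mono)
  define j where "j = min (N - 1) (nat \<lfloor>u\<rfloor>)"
  have j: "j < N" "real j \<le> u" "u \<le> real j + 1"
    using u assms(1) by (auto simp: j_def min_def of_nat_diff) linarith+
  have t: "t = 2 * r * u / real N - r"
    using r N by (simp add: u_def field_simps)
  have eq: "t - (- r + (2 * real j + 1) * r / real N) = (r / real N) * (2 * u - 2 * real j - 1)"
    unfolding t using N by (simp add: field_simps)
  have "\<bar>2 * u - 2 * real j - 1\<bar> \<le> 1" using j by linarith
  then have "\<bar>(r / real N) * (2 * u - 2 * real j - 1)\<bar> \<le> (r / real N) * 1"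
    unfolding abs_mult using r N by (intro mult_mono) auto
  then show ?thesis using j eq by (intro exI[of _ j]) simp
qed

text \<open>The centres of the \<open>N ^ DIM('a)\<close> congruent subcubes of a cube form a net. It serves twice:
  as the set of nodes at which the target is interpolated, and as a discretization of the
  parameter space.\<close>

lemma infnorm_box_cover:
  fixes r :: real
  assumes N: "N \<ge> 1" and r: "r \<ge> 0"
  obtains G :: "'a::euclidean_space set"
  where "finite G" "G \<noteq> {}" "card G \<le> N ^ DIM('a)"
    and "\<And>g. g \<in> G \<Longrightarrow> infnorm g \<le> r"
    and "\<And>x. infnorm x \<le> r \<Longrightarrow> \<exists>g\<in>G. infnorm (x - g) \<le> r / real N"
proof -
  define c where "c j = - r + (2 * real j + 1) * r / real N" for j :: nat
  define v where "v f = (\<Sum>b\<in>Basis. c (f b) *\<^sub>R b)" for f :: "'a \<Rightarrow> nat"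
  define G where "G = v ` (PiE Basis (\<lambda>_. {..<N}))"
  have v_inner: "v f \<bullet> b = c (f b)" if "b \<in> Basis" for f b
    using that by (simp add: v_def inner_sum_left inner_Basis if_distrib cong: if_cong)
  have N0: "real N > 0" using N by simp
  have c: "\<bar>c j\<bar> \<le> r" if "j < N" for j
  proof -
    have "(2 * real j + 1) * r \<le> (2 * real N) * r"
      using that r by (intro mult_right_mono) auto
    then have "(2 * real j + 1) * r / real N \<le> 2 * r"
      using N0 by (simp add: pos_divide_le_eq mult.commute mult.left_commute)
    moreover have "0 \<le> (2 * real j + 1) * r / real N" using r by simp
    ultimately show ?thesis unfolding c_def by linarith
  qed
  show ?thesis
  proof
    show "finite G" unfolding G_def by (intro finite_imageI finite_PiE) auto
    show "G \<noteq> {}" using N unfolding G_def by (auto simp: PiE_eq_empty_iff lessThan_empty_iff)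
    have "card G \<le> card (PiE (Basis::'a set) (\<lambda>_. {..<N}))"
      unfolding G_def by (intro card_image_le finite_PiE) auto
    then show "card G \<le> N ^ DIM('a)" by (simp add: card_PiE)
  next
    fix g assume "g \<in> G"
    then show "infnorm g \<le> r" unfolding G_def
      by (auto intro!: infnorm_leI c simp: v_inner)
  next
    fix x :: 'a assume x: "infnorm x \<le> r"
    have "\<exists>j<N. \<bar>x \<bullet> b - c j\<bar> \<le> r / real N" if "b \<in> Basis" for b
      unfolding c_def using N Basis_le_infnorm[OF that, of x] x by (intro interval_cover) auto
    then obtain f where f: "\<And>b. b \<in> Basis \<Longrightarrow> f b < N \<and> \<bar>x \<bullet> b - c (f b)\<bar> \<le> r / real N"
      by metis
    have "v (restrict f Basis) \<in> G" using f unfolding G_def by auto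
    moreover have "infnorm (x - v (restrict f Basis)) \<le> r / real N"
      using f by (intro infnorm_leI) (simp add: inner_diff_left v_inner)
    ultimately show "\<exists>g\<in>G. infnorm (x - g) \<le> r / real N" by blast
  qed
qed

section \<open>Differences of max-affine functions\<close>

lemma abs_Max_image_diff_le:
  fixes f g :: "'i \<Rightarrow> real"
  assumes A: "finite A" "A \<noteq> {}" and le: "\<And>k. k \<in> A \<Longrightarrow> \<bar>f k - g k\<bar> \<le> e"
  shows "\<bar>Max (f ` A) - Max (g ` A)\<bar> \<le> e"
proof -
  have "Max (f' ` A) \<le> Max (g' ` A) + e" if "\<And>k. k \<in> A \<Longrightarrow> \<bar>f' k - g' k\<bar> \<le> e"
    for f' g' :: "'i \<Rightarrow> real"
  proof -
    have "f' k \<le> Max (g' ` A) + e" if "k \<in> A" for k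
    proof -
      have "g' k \<le> Max (g' ` A)" using A that by (intro Max_ge) auto
      then show ?thesis using \<open>\<And>k. k \<in> A \<Longrightarrow> \<bar>f' k - g' k\<bar> \<le> e\<close>[OF that] by linarith
    qed
    then show ?thesis using A by (subst Max_le_iff) auto
  qed
  from this[of f g] this[of g f] show ?thesis
    using le by (fastforce simp: abs_minus_commute)
qed

lemma abs_inner_le_infnorm:
  fixes x y :: "'a::euclidean_space"
  shows "\<bar>x \<bullet> y\<bar> \<le> real DIM('a) * infnorm x * infnorm y"
proof -
  have "\<bar>x \<bullet> y\<bar> \<le> (\<Sum>b\<in>Basis. \<bar>(x \<bullet> b) * (y \<bullet> b)\<bar>)"
    unfolding euclidean_inner[of x y] by (rule sum_abs)
  also have "\<dots> \<le> (\<Sum>b\<in>(Basis::'a set). infnorm x * infnorm y)"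
    unfolding abs_mult by (intro sum_mono mult_mono Basis_le_infnorm infnorm_pos_le) auto
  finally show ?thesis by simp
qed

lemma infnorm_fst_le: "infnorm (fst z) \<le> infnorm z"
  and infnorm_snd_le: "infnorm (snd z) \<le> infnorm z"
  for z :: "'a::euclidean_space \<times> 'b::euclidean_space"
proof -
  show "infnorm (fst z) \<le> infnorm z"
  proof (rule infnorm_leI)
    fix b :: 'a assume "b \<in> Basis"
    then have "\<bar>z \<bullet> (b, 0)\<bar> \<le> infnorm z" by (intro Basis_le_infnorm) (simp add: Basis_prod_def)
    then show "\<bar>fst z \<bullet> b\<bar> \<le> infnorm z" by (simp add: inner_prod_def)
  qed
  show "infnorm (snd z) \<le> infnorm z"
  proof (rule infnorm_leI)
    fix b :: 'b assume "b \<in> Basis"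
    then have "\<bar>z \<bullet> (0, b)\<bar> \<le> infnorm z" by (intro Basis_le_infnorm) (simp add: Basis_prod_def)
    then show "\<bar>snd z \<bullet> b\<bar> \<le> infnorm z" by (simp add: inner_prod_def)
  qed
qed

lemma infnorm_real: "infnorm (t::real) = \<bar>t\<bar>"
  by (simp add: infnorm_Max)

lemma infnorm_Pair_le:
  fixes x :: "'a::euclidean_space" and y :: "'b::euclidean_space"
  assumes "infnorm x \<le> r" "infnorm y \<le> r"
  shows "infnorm (x, y) \<le> r"
proof (rule infnorm_leI)
  fix b :: "'a \<times> 'b" assume "b \<in> Basis"
  then show "\<bar>(x, y) \<bullet> b\<bar> \<le> r"
    using assms Basis_le_infnorm[of _ x] Basis_le_infnorm[of _ y]
    by (fastforce simp: Basis_prod_def inner_prod_def intro: order_trans)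
qed

lemma param_norm_le_iff:
  assumes "K \<ge> 1"
  shows "param_norm K \<theta> \<le> \<mu> \<longleftrightarrow> (\<forall>k\<in>{1..K}. infnorm (\<theta> k) \<le> \<mu>)"
  using assms unfolding param_norm_def by (subst Max_le_iff) auto

text \<open>A maximum moves by at most the largest displacement of its members, so the two maxima contribute
  one displacement of an affine function each, however many pieces there are.\<close>

lemma dc_fun_parameter_lipschitz:
  fixes x :: "real^'p"
  assumes K: "K \<ge> 1" and x: "infnorm x \<le> r"
    and close: "\<And>k. k \<in> {1..K} \<Longrightarrow> infnorm (\<theta> k - \<theta>' k) \<le> \<eta>"
  shows "\<bar>dc_fun K \<theta> x - dc_fun K \<theta>' x\<bar> \<le> 2 * \<eta> * (real CARD('p) * r + 1)"
proof -
  have affine: "\<bar>(u \<bullet> x + s) - (v \<bullet> x + t)\<bar> \<le> \<eta> * (real CARD('p) * r + 1)"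
    if "infnorm (u - v) \<le> \<eta>" "\<bar>s - t\<bar> \<le> \<eta>" for u v :: "real^'p" and s t
  proof -
    have "\<bar>(u - v) \<bullet> x\<bar> \<le> real CARD('p) * infnorm (u - v) * infnorm x"
      using abs_inner_le_infnorm[of "u - v" x] by simp
    also have "\<dots> \<le> real CARD('p) * \<eta> * r"
      using that x infnorm_pos_le[of x] infnorm_pos_le[of "u - v"] by (intro mult_mono) auto
    finally have "\<bar>u \<bullet> x - v \<bullet> x\<bar> \<le> real CARD('p) * \<eta> * r" by (simp add: inner_diff_left)
    with that(2) show ?thesis by (simp add: algebra_simps)
  qed
  have \<alpha>: "\<bar>(case \<theta> k of (\<alpha>, a, \<beta>, b) \<Rightarrow> \<alpha> \<bullet> x + a) - (case \<theta>' k of (\<alpha>, a, \<beta>, b) \<Rightarrow> \<alpha> \<bullet> x + a)\<bar>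
      \<le> \<eta> * (real CARD('p) * r + 1)"
    and \<beta>: "\<bar>(case \<theta> k of (\<alpha>, a, \<beta>, b) \<Rightarrow> \<beta> \<bullet> x + b) - (case \<theta>' k of (\<alpha>, a, \<beta>, b) \<Rightarrow> \<beta> \<bullet> x + b)\<bar>
      \<le> \<eta> * (real CARD('p) * r + 1)" if "k \<in> {1..K}" for k
  proof -
    obtain u s v t where 1: "\<theta> k = (u, s, v, t)" by (cases "\<theta> k") auto
    obtain u' s' v' t' where 2: "\<theta>' k = (u', s', v', t')" by (cases "\<theta>' k") auto
    let ?w = "(u - u', s - s', v - v', t - t')"
    have w: "infnorm ?w \<le> \<eta>" using close[OF that] by (simp add: 1 2)
    have b: "infnorm (snd ?w) \<le> \<eta>" "infnorm (snd (snd ?w)) \<le> \<eta>"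
      using w infnorm_snd_le[of ?w] infnorm_snd_le[of "snd ?w"] by auto
    have "infnorm (u - u') \<le> \<eta>" "\<bar>s - s'\<bar> \<le> \<eta>" "infnorm (v - v') \<le> \<eta>" "\<bar>t - t'\<bar> \<le> \<eta>"
      using w b infnorm_fst_le[of ?w] infnorm_fst_le[of "snd ?w"] infnorm_fst_le[of "snd (snd ?w)"]
        infnorm_snd_le[of "snd (snd ?w)"] by (auto simp: infnorm_real)
    then show "\<bar>(case \<theta> k of (\<alpha>, a, \<beta>, b) \<Rightarrow> \<alpha> \<bullet> x + a)
          - (case \<theta>' k of (\<alpha>, a, \<beta>, b) \<Rightarrow> \<alpha> \<bullet> x + a)\<bar> \<le> \<eta> * (real CARD('p) * r + 1)"
      and "\<bar>(case \<theta> k of (\<alpha>, a, \<beta>, b) \<Rightarrow> \<beta> \<bullet> x + b)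
          - (case \<theta>' k of (\<alpha>, a, \<beta>, b) \<Rightarrow> \<beta> \<bullet> x + b)\<bar> \<le> \<eta> * (real CARD('p) * r + 1)"
      unfolding 1 2 by (auto intro!: affine)
  qed
  have ne: "finite {1..K}" "{1..K} \<noteq> {}" using K by auto
  have "\<bar>Max ((\<lambda>k. case \<theta> k of (\<alpha>, a, \<beta>, b) \<Rightarrow> \<alpha> \<bullet> x + a) ` {1..K})
      - Max ((\<lambda>k. case \<theta>' k of (\<alpha>, a, \<beta>, b) \<Rightarrow> \<alpha> \<bullet> x + a) ` {1..K})\<bar> \<le> \<eta> * (real CARD('p) * r + 1)"
    by (rule abs_Max_image_diff_le[OF ne]) (rule \<alpha>)
  moreover have "\<bar>Max ((\<lambda>k. case \<theta> k of (\<alpha>, a, \<beta>, b) \<Rightarrow> \<beta> \<bullet> x + b) ` {1..K})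
      - Max ((\<lambda>k. case \<theta>' k of (\<alpha>, a, \<beta>, b) \<Rightarrow> \<beta> \<bullet> x + b) ` {1..K})\<bar> \<le> \<eta> * (real CARD('p) * r + 1)"
    by (rule abs_Max_image_diff_le[OF ne]) (rule \<beta>)
  ultimately show ?thesis unfolding dc_fun_def by linarith
qed

lemma dc_fun_bounded:
  fixes x :: "real^'p"
  assumes K: "K \<ge> 1" and x: "infnorm x \<le> r" and \<theta>: "param_norm K \<theta> \<le> \<mu>"
  shows "\<bar>dc_fun K \<theta> x\<bar> \<le> 2 * \<mu> * (real CARD('p) * r + 1)"
proof -
  \<comment> \<open>Compare with the zero parameter, whose function vanishes.\<close>
  have "(\<lambda>_. 0) ` {1..K} = {0::real}" using K by auto
  then have "dc_fun K (\<lambda>_. 0) x = 0" by (simp add: dc_fun_def zero_prod_def)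
  with dc_fun_parameter_lipschitz[OF K x, of \<theta> "\<lambda>_. 0" \<mu>] \<theta> K
  show ?thesis by (simp add: param_norm_le_iff)
qed

lemma dc_class_measurable:
  assumes "(f :: real^'p \<Rightarrow> real^'d) \<in> dc_class K \<mu>"
  shows "f \<in> borel_measurable borel"
proof -
  obtain \<theta> :: "'d \<Rightarrow> nat \<Rightarrow> 'p block" where f: "f = (\<lambda>x. \<chi> \<iota>. dc_fun K (\<theta> \<iota>) x)"
    using assms unfolding dc_class_def by blast
  have dc: "dc_fun K \<theta>' \<in> borel_measurable borel" for \<theta>' :: "nat \<Rightarrow> 'p block"
    unfolding dc_fun_def
    by (intro borel_measurable_diff borel_measurable_Max) (auto split: prod.split)
  show ?thesis
  proof (subst borel_measurable_euclidean_space, intro ballI)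
    fix b :: "real^'d" assume "b \<in> Basis"
    then obtain i where "b = axis i 1" by (auto simp: Basis_vec_def)
    then show "(\<lambda>x. f x \<bullet> b) \<in> borel_measurable borel"
      using dc[of "\<theta> i"] unfolding f by (simp add: cart_eq_inner_axis[symmetric])
  qed
qed

lemma dc_class_norm_le:
  fixes f :: "real^'p \<Rightarrow> real^'d"
  assumes f: "f \<in> dc_class K \<mu>" and K: "K \<ge> 1" and x: "infnorm x \<le> r"
  shows "norm (f x) \<le> sqrt CARD('d) * (2 * \<mu> * (real CARD('p) * r + 1))"
proof -
  obtain \<theta> :: "'d \<Rightarrow> nat \<Rightarrow> 'p block"
    where \<theta>: "\<And>\<iota>. param_norm K (\<theta> \<iota>) \<le> \<mu>" and f_eq: "f = (\<lambda>x. \<chi> \<iota>. dc_fun K (\<theta> \<iota>) x)"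
    using f unfolding dc_class_def by blast
  show ?thesis using dc_fun_bounded[OF K x \<theta>] by (intro norm_le_sqrt_card) (simp add: f_eq)
qed

text \<open>Rounding every block of a parameter to a net of the box of blocks rounds the whole class to
  finitely many functions; the exponent is the number of real parameters.\<close>

lemma dc_class_finite_net:
  assumes K: "K \<ge> 1" and N: "N \<ge> 1" and \<mu>: "\<mu> \<ge> 0"
  obtains H :: "(real^'p \<Rightarrow> real^'d) set"
  where "finite H" "H \<subseteq> dc_class K \<mu>"
    and "card H \<le> N ^ (2 * CARD('d) * K * (CARD('p) + 1))"
    and "\<And>f. f \<in> dc_class K \<mu> \<Longrightarrow>
      \<exists>h\<in>H. \<forall>x r. infnorm x \<le> r \<longrightarrow>
        norm (f x - h x) \<le> 2 * sqrt CARD('d) * (\<mu> / real N) * (real CARD('p) * r + 1)"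
proof -
  obtain G :: "'p block set" where G: "finite G" "card G \<le> N ^ DIM('p block)"
    "\<And>g. g \<in> G \<Longrightarrow> infnorm g \<le> \<mu>"
    "\<And>x. infnorm x \<le> \<mu> \<Longrightarrow> \<exists>g\<in>G. infnorm (x - g) \<le> \<mu> / real N"
    using infnorm_box_cover[OF N \<mu>] by metis
  define \<Theta> :: "('d \<Rightarrow> nat \<Rightarrow> 'p block) set"
    where "\<Theta> = PiE UNIV (\<lambda>_. PiE {1..K} (\<lambda>_. G))"
  define v :: "('d \<Rightarrow> nat \<Rightarrow> 'p block) \<Rightarrow> real^'p \<Rightarrow> real^'d"
    where "v \<theta> = (\<lambda>x. \<chi> \<iota>. dc_fun K (\<theta> \<iota>) x)" for \<theta>
  have fin: "finite \<Theta>" unfolding \<Theta>_def using G(1) by (intro finite_PiE) auto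
  have "card (v ` \<Theta>) \<le> card \<Theta>" using fin by (rule card_image_le)
  also have "card \<Theta> = (card G ^ K) ^ CARD('d)" by (simp add: \<Theta>_def card_PiE)
  also have "\<dots> \<le> ((N ^ (2 * (CARD('p) + 1))) ^ K) ^ CARD('d)"
    using G(2) by (intro power_mono) (auto simp: algebra_simps mult_2_right)
  also have "\<dots> = N ^ (2 * CARD('d) * K * (CARD('p) + 1))"
    unfolding power_mult[symmetric] by (simp only: ac_simps)
  finally have card: "card (v ` \<Theta>) \<le> N ^ (2 * CARD('d) * K * (CARD('p) + 1))" .
  show ?thesis
  proof
    show "finite (v ` \<Theta>)" using fin by simp
    show "card (v ` \<Theta>) \<le> N ^ (2 * CARD('d) * K * (CARD('p) + 1))" by (rule card)
    have "param_norm K (\<theta> \<iota>) \<le> \<mu>" if "\<theta> \<in> \<Theta>" for \<theta> \<iota>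
    proof -
      have "\<theta> \<iota> k \<in> G" if "k \<in> {1..K}" for k
        using \<open>\<theta> \<in> \<Theta>\<close> that unfolding \<Theta>_def by (meson PiE_mem UNIV_I)
      then show ?thesis using K G(3) by (simp add: param_norm_le_iff)
    qed
    then have "v \<theta> \<in> dc_class K \<mu>" if "\<theta> \<in> \<Theta>" for \<theta>
      unfolding v_def dc_class_def mem_Collect_eq using that by (intro exI[of _ \<theta>]) blast
    then show "v ` \<Theta> \<subseteq> dc_class K \<mu>" by blast
  next
    fix f :: "real^'p \<Rightarrow> real^'d"
    assume "f \<in> dc_class K \<mu>"
    then obtain \<theta> :: "'d \<Rightarrow> nat \<Rightarrow> 'p block"
      where "\<And>\<iota>. param_norm K (\<theta> \<iota>) \<le> \<mu>" and f: "f = v \<theta>"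
      unfolding dc_class_def v_def mem_Collect_eq by blast
    then have \<theta>: "infnorm (\<theta> \<iota> k) \<le> \<mu>" if "k \<in> {1..K}" for \<iota> k
      using K that by (simp add: param_norm_le_iff)
    from G(4) obtain g where g: "\<And>b. infnorm b \<le> \<mu> \<Longrightarrow> g b \<in> G \<and> infnorm (b - g b) \<le> \<mu> / real N"
      by metis
    define \<theta>' where "\<theta>' = (\<lambda>\<iota>. restrict (\<lambda>k. g (\<theta> \<iota> k)) {1..K})"
    have "g (\<theta> \<iota> k) \<in> G" if "k \<in> {1..K}" for \<iota> k using g[OF \<theta>[OF that]] by blast
    then have "\<theta>' \<in> \<Theta>" unfolding \<theta>'_def \<Theta>_def by (intro PiE_I restrict_PiE_iff[THEN iffD2] ballI) auto
    moreover have "norm (f x - v \<theta>' x)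
        \<le> 2 * sqrt CARD('d) * (\<mu> / real N) * (real CARD('p) * r + 1)" if "infnorm x \<le> r" for x r
    proof -
      have "\<bar>dc_fun K (\<theta> \<iota>) x - dc_fun K (\<theta>' \<iota>) x\<bar> \<le> 2 * (\<mu> / real N) * (real CARD('p) * r + 1)" for \<iota>
        using g \<theta> by (intro dc_fun_parameter_lipschitz K that) (auto simp: \<theta>'_def)
      then have "norm (f x - v \<theta>' x) \<le> sqrt CARD('d) * (2 * (\<mu> / real N) * (real CARD('p) * r + 1))"
        by (intro norm_le_sqrt_card) (simp add: f v_def)
      then show ?thesis by (simp only: mult_ac)
    qed
    ultimately show "\<exists>h\<in>v ` \<Theta>. \<forall>x r. infnorm x \<le> r \<longrightarrow>
        norm (f x - h x) \<le> 2 * sqrt CARD('d) * (\<mu> / real N) * (real CARD('p) * r + 1)"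
      by blast
  qed
qed

section \<open>Approximation of Lipschitz functions\<close>

text \<open>McShane's extension by the lower envelope of the cones \<open>f y + L * dist x y\<close>; cutting it off
  at \<open>B\<close> preserves the bound.\<close>

lemma bounded_lipschitz_extension:
  fixes f :: "'a::metric_space \<Rightarrow> real"
  assumes S: "S \<noteq> {}" and lip: "L-lipschitz_on S f" and bound: "\<And>x. x \<in> S \<Longrightarrow> \<bar>f x\<bar> \<le> B"
  obtains F where "L-lipschitz_on UNIV F" "\<And>x. x \<in> S \<Longrightarrow> F x = f x" "\<And>x. \<bar>F x\<bar> \<le> B"
proof -
  have L: "L \<ge> 0" using lip by (rule lipschitz_on_nonneg)
  have B: "B \<ge> 0" using S bound by (metis abs_ge_zero all_not_in_conv order_trans)
  define E where "E x = (INF y\<in>S. f y + L * dist x y)" for x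
  have ge: "- B \<le> f y + L * dist x y" if "y \<in> S" for x y
    using bound[OF that] L by (smt (verit) mult_nonneg_nonneg zero_le_dist)
  have bdd: "bdd_below ((\<lambda>y. f y + L * dist x y) ` S)" for x
    using ge by (auto intro!: bdd_belowI[of _ "- B"])
  have E_le: "E x \<le> f y + L * dist x y" if "y \<in> S" for x y
    unfolding E_def using bdd that by (rule cINF_lower)
  have E_ge: "- B \<le> E x" for x unfolding E_def using S ge by (intro cINF_greatest) auto
  have E_diff: "E x \<le> E x' + L * dist x x'" for x x'
  proof -
    have "E x - L * dist x x' \<le> f y + L * dist x' y" if "y \<in> S" for y
    proof -
      have "L * dist x y \<le> L * (dist x x' + dist x' y)" using L by (intro mult_left_mono dist_triangle)
      with E_le[OF that, of x] show ?thesis by (simp add: algebra_simps)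
    qed
    then have "E x - L * dist x x' \<le> E x'" unfolding E_def[of x'] using S by (intro cINF_greatest)
    then show ?thesis by simp
  qed
  have E_eq: "E x = f x" if "x \<in> S" for x
  proof (rule antisym)
    show "E x \<le> f x" using E_le[OF that, of x] by simp
    show "f x \<le> E x" unfolding E_def
    proof (intro cINF_greatest S)
      fix y assume "y \<in> S"
      with lipschitz_onD[OF lip that this] show "f x \<le> f y + L * dist x y" by (simp add: dist_real_def)
    qed
  qed
  show ?thesis
  proof
    show "L-lipschitz_on UNIV (\<lambda>x. min B (E x))"
    proof (rule lipschitz_onI[OF _ L])
      fix x x' show "dist (min B (E x)) (min B (E x')) \<le> L * dist x x'"
        using E_diff[of x x'] E_diff[of x' x] by (auto simp: dist_real_def dist_commute[of x'])
    qed
    show "min B (E x) = f x" if "x \<in> S" for x using E_eq[OF that] bound[OF that] by auto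
    show "\<bar>min B (E x)\<bar> \<le> B" for x using E_ge[of x] B by auto
  qed
qed

text \<open>The maximum of finitely many downward paraboloids with apices on the graph of \<open>f\<close>. A single
  one exceeds \<open>f x\<close> by at most \<open>L * t - c * t\<^sup>2 \<le> L\<^sup>2 / (4 * c)\<close> at distance \<open>t\<close> from its apex, and the
  nearest one is not far below \<open>f x\<close>.\<close>

lemma paraboloid_envelope_error:
  fixes f :: "'a::real_normed_vector \<Rightarrow> real" and g :: "'i \<Rightarrow> 'a"
  assumes A: "finite A" and lip: "L-lipschitz_on UNIV f" and c: "c > 0"
    and near: "i \<in> A" "norm (x - g i) \<le> D"
  shows "Max ((\<lambda>k. f (g k) - c * (norm (x - g k))\<^sup>2) ` A) \<le> f x + L\<^sup>2 / (4 * c)"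
    and "f x - L * D - c * D\<^sup>2 \<le> Max ((\<lambda>k. f (g k) - c * (norm (x - g k))\<^sup>2) ` A)"
proof -
  have diff: "\<bar>f (g k) - f x\<bar> \<le> L * norm (x - g k)" for k
    using lipschitz_onD[OF lip, of "g k" x] by (simp add: dist_real_def dist_norm norm_minus_commute)
  have "f (g k) - c * (norm (x - g k))\<^sup>2 \<le> f x + L\<^sup>2 / (4 * c)" for k
  proof -
    define t where "t = norm (x - g k)"
    \<comment> \<open>Complete the square.\<close>
    have "0 \<le> c * (t - L / (2 * c))\<^sup>2" using c by simp
    also have "\<dots> = c * t\<^sup>2 - L * t + L\<^sup>2 / (4 * c)"
      using c by (simp add: power2_eq_square field_simps)
    finally show ?thesis using diff[of k] unfolding t_def[symmetric] by linarith
  qed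
  then show "Max ((\<lambda>k. f (g k) - c * (norm (x - g k))\<^sup>2) ` A) \<le> f x + L\<^sup>2 / (4 * c)"
    using A near(1) by (subst Max_le_iff) auto
  have "L * norm (x - g i) \<le> L * D" "c * (norm (x - g i))\<^sup>2 \<le> c * D\<^sup>2"
    using near(2) c lipschitz_on_nonneg[OF lip] by (auto intro!: mult_left_mono power_mono)
  with diff[of i] have "f x - L * D - c * D\<^sup>2 \<le> f (g i) - c * (norm (x - g i))\<^sup>2" by linarith
  also have "\<dots> \<le> Max ((\<lambda>k. f (g k) - c * (norm (x - g k))\<^sup>2) ` A)"
    using A near(1) by (intro Max_ge) auto
  finally show "f x - L * D - c * D\<^sup>2 \<le> Max ((\<lambda>k. f (g k) - c * (norm (x - g k))\<^sup>2) ` A)" .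
qed

text \<open>Both maxima are paraboloid envelopes, of \<open>f / 2\<close> and of \<open>- f / 2\<close>, without their
  common part \<open>- c * (norm x)\<^sup>2\<close>, which cancels in the difference; what is left of each paraboloid is
  affine. Splitting \<open>f\<close> evenly halves its contribution to the intercepts. Let \<open>D\<close> be the
  mesh of a grid of \<open>K\<close> nodes. With \<open>c\<close> of order \<open>L * K powr (1/p) / r\<close>, the errors
  \<open>L * D\<close>, \<open>c * D\<^sup>2\<close> and \<open>L\<^sup>2 / c\<close> all have the order
  \<open>L * r * K powr (- 1/p)\<close>.\<close>

lemma dc_fun_approximates_lipschitz:
  fixes f :: "real^'p \<Rightarrow> real"
  defines "p \<equiv> real CARD('p)"
  assumes S: "S \<noteq> {}" "\<And>x. x \<in> S \<Longrightarrow> infnorm x \<le> r"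
    and L: "L > 0" and lip: "L-lipschitz_on S f" and bound: "\<And>x. x \<in> S \<Longrightarrow> \<bar>f x\<bar> \<le> B"
    and K: "K \<ge> 1"
    and \<mu>: "\<mu> \<ge> 1/2 * L * real K powr (1 / p)"
      "\<mu> \<ge> 1/4 * p * L * r * real K powr (1 / p) + 1/2 * B"
  shows "\<exists>\<theta>. param_norm K \<theta> \<le> \<mu> \<and> (\<forall>x\<in>S. \<bar>dc_fun K \<theta> x - f x\<bar>
    \<le> 2 * (sqrt p + 3) * sqrt p * L * r * real K powr (- 1 / p))"
proof (cases "r = 0")
  \<comment> \<open>On a single point no curvature can be chosen from \<open>r\<close>, and constants are exact.\<close>
  case True
  define t where "t = f 0 / 2"
  have S0: "S = {0}" using S infnorm_pos_le infnorm_eq_0 True by (metis antisym is_singletonI' is_singleton_def singleton_iff)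
  define \<theta> :: "nat \<Rightarrow> 'p block" where "\<theta> = (\<lambda>k. (0, t, 0, - t))"
  have "\<bar>t\<bar> \<le> \<mu>" using \<mu>(2) True bound[of 0] S0 by (simp add: t_def)
  then have "param_norm K \<theta> \<le> \<mu>"
    using K by (auto simp: param_norm_le_iff \<theta>_def infnorm_0 infnorm_real intro!: infnorm_Pair_le)
  moreover have "dc_fun K \<theta> 0 = f 0"
    using K by (simp add: dc_fun_def \<theta>_def t_def)
  ultimately show ?thesis using S0 True by auto
next
  case False
  then have r: "r > 0" using S infnorm_pos_le by (metis all_not_in_conv order.trans order_le_less)
  have p: "p \<ge> 1" unfolding p_def by (simp add: Suc_leI)
  obtain F where F: "L-lipschitz_on UNIV F" "\<And>x. x \<in> S \<Longrightarrow> F x = f x" "\<And>x. \<bar>F x\<bar> \<le> B"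
    using bounded_lipschitz_extension[OF S(1) lip bound] by metis
  define R where "R = real K powr (1 / p)"
  have R: "R \<ge> 1" unfolding R_def using K p by (intro ge_one_powr_ge_zero) auto
  define N where "N = nat \<lfloor>R\<rfloor>"
  have N: "N \<ge> 1" "real N \<le> R" using R by (auto simp: N_def le_nat_iff)
  \<comment> \<open>Rounding \<open>R\<close> down to an integer at most doubles the mesh, since \<open>R \<ge> 1\<close>.\<close>
  have "R \<le> real N + 1" using R by (simp add: N_def)
  then have RN: "R \<le> 2 * real N" using N(1) by linarith
  have "real N ^ CARD('p) \<le> R ^ CARD('p)" using N by (intro power_mono) auto
  also have "\<dots> = real K"
    using K p unfolding R_def p_def by (simp add: powr_realpow[symmetric] powr_powr)
  finally have NK: "N ^ CARD('p) \<le> K" by (metis of_nat_le_iff of_nat_power)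
  obtain G :: "(real^'p) set" where G: "finite G" "G \<noteq> {}" "card G \<le> N ^ CARD('p)"
    "\<And>g. g \<in> G \<Longrightarrow> infnorm g \<le> r"
    "\<And>x. infnorm x \<le> r \<Longrightarrow> \<exists>g\<in>G. infnorm (x - g) \<le> r / real N"
    using infnorm_box_cover[of N r, where 'a="real^'p"] N(1) r by auto
  obtain g where g: "g ` {1..K} = G"
    using card_le_inj[OF G(1), of "{1..K}"] inj_on_iff_surj[OF G(2), of "{1..K}"] G(3) NK by auto
  have norm_le: "norm y \<le> sqrt p * s" if "infnorm y \<le> s" for y :: "real^'p" and s
  proof -
    have "norm y \<le> sqrt p * infnorm y" using norm_le_infnorm[of y] by (simp add: p_def)
    also have "\<dots> \<le> sqrt p * s" using that p by (intro mult_left_mono) auto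
    finally show ?thesis .
  qed
  \<comment> \<open>This is the largest curvature whose slopes \<open>2 * c * g k\<close> are bounded by
    \<open>L * R / 2\<close>, the first lower bound for \<open>\<mu>\<close>.\<close>
  define c where "c = L * R / (4 * r)"
  have c: "c > 0" using L R r by (simp add: c_def)
  define D where "D = sqrt p * (r / real N)"
  define \<theta> :: "nat \<Rightarrow> 'p block" where "\<theta> = (\<lambda>k.
    ((2 * c) *\<^sub>R g k, F (g k) / 2 - c * (norm (g k))\<^sup>2, (2 * c) *\<^sub>R g k, - F (g k) / 2 - c * (norm (g k))\<^sup>2))"
  have g_infnorm: "infnorm (g k) \<le> r" if "k \<in> {1..K}" for k using G(4) g that by blast
  have "infnorm (\<theta> k) \<le> \<mu>" if k: "k \<in> {1..K}" for k
  proof -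
    have "norm (g k) \<le> sqrt p * r"
      by (rule norm_le[OF g_infnorm[OF k]])
    then have "(norm (g k))\<^sup>2 \<le> (sqrt p * r)\<^sup>2" by (intro power_mono) auto
    then have "c * (norm (g k))\<^sup>2 \<le> c * (p * r\<^sup>2)"
      using c p by (intro mult_left_mono) (auto simp: power_mult_distrib)
    also have "\<dots> = 1/4 * p * L * r * R" using r by (simp add: c_def power2_eq_square)
    finally have 1: "c * (norm (g k))\<^sup>2 \<le> 1/4 * p * L * r * R" .
    have "0 \<le> c * (norm (g k))\<^sup>2" using c by simp
    then have 2: "\<bar>F (g k) / 2 - c * (norm (g k))\<^sup>2\<bar> \<le> \<mu>" "\<bar>- F (g k) / 2 - c * (norm (g k))\<^sup>2\<bar> \<le> \<mu>"
      using 1 \<mu>(2) F(3)[of "g k"] unfolding R_def[symmetric] by linarith+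
    have "infnorm ((2 * c) *\<^sub>R g k) \<le> 2 * c * r"
      using c g_infnorm[OF k] by (simp add: infnorm_mul)
    also have "\<dots> \<le> \<mu>" using \<mu>(1) r by (simp add: c_def R_def)
    finally show ?thesis using 2 unfolding \<theta>_def
      by (intro infnorm_Pair_le) (auto simp: infnorm_real)
  qed
  then have "param_norm K \<theta> \<le> \<mu>" using K by (simp add: param_norm_le_iff)
  moreover have "\<bar>dc_fun K \<theta> x - f x\<bar>
    \<le> 2 * (sqrt p + 3) * sqrt p * L * r * real K powr (- 1 / p)" if xS: "x \<in> S" for x
  proof -
    have ne: "finite {1..K}" "{1..K} \<noteq> {}" using K by auto
    define m where "m h = Max ((\<lambda>k. h (g k) - c * (norm (x - g k))\<^sup>2) ` {1..K})" for h
    have affine: "((2 * c) *\<^sub>R g k) \<bullet> x + (h - c * (norm (g k))\<^sup>2)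
        = (h - c * (norm (x - g k))\<^sup>2) + c * (norm x)\<^sup>2" for k h
      by (simp add: power2_norm_eq_inner inner_diff inner_commute algebra_simps)
    have dc: "dc_fun K \<theta> x = m (\<lambda>z. F z / 2) - m (\<lambda>z. - F z / 2)"
      unfolding dc_fun_def \<theta>_def m_def prod.case affine
      by (subst (1 2) Max_add_commute[OF ne]) simp
    obtain i where i: "i \<in> {1..K}" "norm (x - g i) \<le> D"
    proof -
      obtain i where i: "i \<in> {1..K}" "infnorm (x - g i) \<le> r / real N"
        using G(5)[OF S(2)[OF xS]] g by blast
      have "norm (x - g i) \<le> D"
        unfolding D_def by (rule norm_le[OF i(2)])
      with i(1) show thesis by (rule that)
    qed
    have lip2: "(L / 2)-lipschitz_on UNIV (\<lambda>z. F z / 2)" "(L / 2)-lipschitz_on UNIV (\<lambda>z. - F z / 2)"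
      using lipschitz_on_nonneg[OF F(1)] lipschitz_onD[OF F(1)]
      by (auto intro!: lipschitz_onI simp: dist_real_def field_simps)
    have upper: "m h \<le> h x + (L / 2)\<^sup>2 / (4 * c)" and lower: "h x - L / 2 * D - c * D\<^sup>2 \<le> m h"
      if "(L / 2)-lipschitz_on UNIV h" for h
      using paraboloid_envelope_error[where g=g, OF ne(1) that c i] unfolding m_def by simp_all
    have err: "\<bar>dc_fun K \<theta> x - f x\<bar> \<le> L / 2 * D + c * D\<^sup>2 + (L / 2)\<^sup>2 / (4 * c)"
      using upper[OF lip2(1)] upper[OF lip2(2)] lower[OF lip2(1)] lower[OF lip2(2)]
      unfolding dc F(2)[OF xS, symmetric] by linarith
    define s where "s = L * r / R"
    have s: "s > 0" using L r R by (simp add: s_def)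
    have "D \<le> sqrt p * (2 * r / R)" unfolding D_def
      using N RN R r p by (intro mult_left_mono) (auto simp: field_simps)
    moreover have D0: "D \<ge> 0" unfolding D_def using p r by simp
    ultimately have "L / 2 * D \<le> L / 2 * (sqrt p * (2 * r / R))" "c * D\<^sup>2 \<le> c * (sqrt p * (2 * r / R))\<^sup>2"
      using L c by (intro mult_left_mono power_mono; simp)+
    moreover have "L / 2 * (sqrt p * (2 * r / R)) = sqrt p * s" by (simp add: s_def)
    moreover have "c * (sqrt p * (2 * r / R))\<^sup>2 = p * s"
      using r R p by (simp add: c_def s_def power2_eq_square field_simps)
    moreover have "(L / 2)\<^sup>2 / (4 * c) = s / 4"
      using r R L by (simp add: c_def s_def power2_eq_square field_simps)
    ultimately have "\<bar>dc_fun K \<theta> x - f x\<bar> \<le> sqrt p * s + p * s + s / 4"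
      using err by linarith
    also have "\<dots> \<le> (2 * (sqrt p + 3) * sqrt p) * s"
    proof -
      have "sqrt p \<ge> 1" using p by simp
      moreover have "2 * (sqrt p + 3) * sqrt p = 2 * p + 6 * sqrt p"
        using p by (simp add: distrib_left distrib_right mult.assoc)
      ultimately have "sqrt p + p + 1 / 4 \<le> 2 * (sqrt p + 3) * sqrt p" using p by linarith
      then have "(sqrt p + p + 1 / 4) * s \<le> (2 * (sqrt p + 3) * sqrt p) * s"
        using s by (intro mult_right_mono) auto
      then show ?thesis by (simp add: algebra_simps)
    qed
    also have "\<dots> = 2 * (sqrt p + 3) * sqrt p * L * r * real K powr (- 1 / p)"
      by (simp add: s_def R_def powr_minus divide_inverse)
    finally show ?thesis .
  qed
  ultimately show ?thesis by blast
qed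

lemma dc_class_approximates_lipschitz:
  fixes f :: "real^'p \<Rightarrow> real^'d"
  defines "p \<equiv> real CARD('p)"
  assumes S: "S \<noteq> {}" "\<And>x. x \<in> S \<Longrightarrow> infnorm x \<le> r"
    and L: "L > 0" and f: "f \<in> lipschitz_class S L B"
    and K: "K \<ge> 1"
    and \<mu>: "\<mu> \<ge> 1/2 * L * real K powr (1 / p)"
      "\<mu> \<ge> 1/4 * p * L * r * real K powr (1 / p) + 1/2 * B"
  shows "\<exists>g\<in>dc_class K \<mu>. \<forall>x\<in>S. norm (g x - f x)
    \<le> sqrt CARD('d) * (2 * (sqrt p + 3) * sqrt p * L * r * real K powr (- 1 / p))"
proof -
  let ?e = "2 * (sqrt p + 3) * sqrt p * L * r * real K powr (- 1 / p)"
  have lip: "L-lipschitz_on S (\<lambda>x. f x $ i)" for i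
  proof (rule lipschitz_onI)
    have f_lip: "L-lipschitz_on S f" using f by (simp add: lipschitz_class_def)
    fix x y assume "x \<in> S" "y \<in> S"
    with dist_vec_nth_le[of "f x" i "f y"] lipschitz_onD[OF f_lip]
    show "dist (f x $ i) (f y $ i) \<le> L * dist x y" by (metis order_trans)
  qed (use L in simp)
  have bound: "\<bar>f x $ i\<bar> \<le> B" if "x \<in> S" for x i
  proof -
    have "ereal (infnorm (f x)) \<le> ereal B"
      using f that unfolding lipschitz_class_def sup_norm_on_def by (auto simp: SUP_le_iff)
    with component_le_infnorm_cart[of "f x" i] show ?thesis by simp
  qed
  have "\<forall>i. \<exists>\<theta>. param_norm K \<theta> \<le> \<mu> \<and> (\<forall>x\<in>S. \<bar>dc_fun K \<theta> x - f x $ i\<bar> \<le> ?e)"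
    using dc_fun_approximates_lipschitz[OF S L lip bound K \<mu>[unfolded p_def]]
    unfolding p_def by blast
  then obtain \<theta> where \<theta>: "\<And>i. param_norm K (\<theta> i) \<le> \<mu>"
    "\<And>i x. x \<in> S \<Longrightarrow> \<bar>dc_fun K (\<theta> i) x - f x $ i\<bar> \<le> ?e" by metis
  define g :: "real^'p \<Rightarrow> real^'d" where "g x = (\<chi> i. dc_fun K (\<theta> i) x)" for x
  have "g \<in> dc_class K \<mu>" unfolding dc_class_def g_def using \<theta>(1) by blast
  moreover have "norm (g x - f x) \<le> sqrt CARD('d) * ?e" if "x \<in> S" for x
    using \<theta>(2)[OF that] by (intro norm_le_sqrt_card) (simp add: g_def)
  ultimately show ?thesis by blast
qed

section \<open>Supports and truncated losses\<close>

lemma closed_rv_support: "closed (rv_support M Z)"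
  unfolding rv_support_def by (intro closed_Inter) auto

text \<open>In a second-countable space the union of all open null sets is a countable one of them, so it
  is null.\<close>

lemma AE_in_rv_support:
  fixes Z :: "'w \<Rightarrow> 'b::second_countable_topology"
  shows "AE w in M. Z w \<in> rv_support M Z"
proof -
  define F where "F = {U :: 'b set. open U \<and> (AE w in M. Z w \<notin> U)}"
  obtain F' where F': "F' \<subseteq> F" "countable F'" "\<Union>F' = \<Union>F"
    using Lindelof[of F] by (auto simp: F_def)
  have "AE w in M. \<forall>U\<in>F'. Z w \<notin> U"
    using F'(1,2) by (subst AE_ball_countable) (auto simp: F_def)
  moreover have "Z w \<in> rv_support M Z" if "\<forall>U\<in>F'. Z w \<notin> U" for w
  proof -
    have "Z w \<in> C" if "closed C" "AE w in M. Z w \<in> C" for C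
    proof -
      have "- C \<in> F" using that by (auto simp: F_def)
      with F'(3) \<open>\<forall>U\<in>F'. Z w \<notin> U\<close> show ?thesis by blast
    qed
    then show ?thesis by (auto simp: rv_support_def)
  qed
  ultimately show ?thesis by (auto elim: AE_mp)
qed

text \<open>The function \<open>g\<close> itself may fail to be measurable: it only has to agree with an
  integrable one outside a null set.\<close>

lemma ext_expectation_eq_integral:
  assumes g': "integrable M g'" and eq: "AE w in M. g w = g' w"
  shows "ext_expectation M g = ereal (\<integral>w. g' w \<partial>M)"
proof -
  have 1: "(\<integral>\<^sup>+ w. ennreal (g w) \<partial>M) = (\<integral>\<^sup>+ w. ennreal (g' w) \<partial>M)"
    "(\<integral>\<^sup>+ w. ennreal (- g w) \<partial>M) = (\<integral>\<^sup>+ w. ennreal (- g' w) \<partial>M)"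
    using eq by (auto intro!: nn_integral_cong_AE)
  have fin: "(\<integral>\<^sup>+ w. ennreal (g' w) \<partial>M) \<noteq> \<infinity>" "(\<integral>\<^sup>+ w. ennreal (- g' w) \<partial>M) \<noteq> \<infinity>"
    using g' by (auto simp: real_integrable_def)
  have *: "enn2ereal a = ereal (enn2real a)" if "a \<noteq> \<infinity>" for a
    using that by (cases a rule: ennreal_cases) (auto simp: enn2ereal_ennreal)
  show ?thesis
    unfolding ext_expectation_def 1 *[OF fin(1)] *[OF fin(2)] real_lebesgue_integral_def[OF g']
    by simp
qed

text \<open>The loss is controlled only on the supports, which carry the samples almost surely. Setting it
  to \<open>0\<close> elsewhere makes it measurable on the whole product space and bounded everywhere,
  without changing the risk.\<close>

definition truncated_loss ::
  "('z \<Rightarrow> 'y \<Rightarrow> real) \<Rightarrow> 'x set \<Rightarrow> 'y set \<Rightarrow> ('x \<Rightarrow> 'z) \<Rightarrow> 'x \<times> 'y \<Rightarrow> real" where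
  "truncated_loss \<phi> S T f = (\<lambda>(x, y). if x \<in> S \<and> y \<in> T then \<phi> (f x) y else 0)"

lemma truncated_loss_measurable:
  fixes f :: "real^'p \<Rightarrow> real^'d" and T :: "'y::topological_space set"
  assumes S: "S \<in> sets borel" and T: "T \<in> sets borel" and f: "f \<in> predictors S"
    and \<phi>: "(\<lambda>(z, y). \<phi> z y) \<in> borel \<Otimes>\<^sub>M restrict_space borel T \<rightarrow>\<^sub>M borel"
  shows "truncated_loss \<phi> S T f \<in> borel \<Otimes>\<^sub>M borel \<rightarrow>\<^sub>M borel"
proof -
  let ?N = "borel \<Otimes>\<^sub>M borel :: ((real^'p) \<times> 'y) measure"
  let ?R = "restrict_space ?N (S \<times> T)"
  have ST: "S \<times> T \<in> sets ?N" using S T by (rule pair_measureI)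
  have sp: "space ?R \<subseteq> S \<times> T" by (auto simp: space_restrict_space)
  have fst: "fst \<in> ?R \<rightarrow>\<^sub>M restrict_space borel S"
    using sp by (intro measurable_restrict_space2 measurable_restrict_space1 measurable_fst) auto
  have snd: "snd \<in> ?R \<rightarrow>\<^sub>M restrict_space borel T"
    using sp by (intro measurable_restrict_space2 measurable_restrict_space1 measurable_snd) auto
  have "(\<lambda>z. f (fst z)) \<in> ?R \<rightarrow>\<^sub>M borel"
    using measurable_compose[OF fst f[unfolded predictors_def]] .
  then have "(\<lambda>z. (f (fst z), snd z)) \<in> ?R \<rightarrow>\<^sub>M borel \<Otimes>\<^sub>M restrict_space borel T"
    using snd by (rule measurable_Pair)
  from measurable_compose[OF this \<phi>]
  have "(\<lambda>z. \<phi> (f (fst z)) (snd z)) \<in> ?R \<rightarrow>\<^sub>M borel" by simp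
  then have "(\<lambda>z. if z \<in> S \<times> T then \<phi> (f (fst z)) (snd z) else 0) \<in> ?N \<rightarrow>\<^sub>M borel"
    using ST by (subst measurable_If_restrict_space_iff) auto
  also have "(\<lambda>z. if z \<in> S \<times> T then \<phi> (f (fst z)) (snd z) else 0) = truncated_loss \<phi> S T f"
    by (auto simp: truncated_loss_def fun_eq_iff)
  finally show ?thesis .
qed

lemma truncated_loss_bounded:
  fixes f :: "'x \<Rightarrow> 'z::real_normed_vector"
  assumes lip: "\<And>y. y \<in> T \<Longrightarrow> L-lipschitz_on UNIV (\<lambda>z. \<phi> z y)"
    and base: "\<And>y. y \<in> T \<Longrightarrow> \<bar>\<phi> z0 y\<bar> \<le> C" and pos: "C \<ge> 0" "L \<ge> 0" "b \<ge> 0"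
    and f: "\<And>x. x \<in> S \<Longrightarrow> norm (f x) \<le> b"
  shows "\<bar>truncated_loss \<phi> S T f z\<bar> \<le> C + L * (b + norm z0)"
proof (cases "z \<in> S \<times> T")
  case True
  then obtain x y where z: "z = (x, y)" "x \<in> S" "y \<in> T" by auto
  have "\<bar>\<phi> (f x) y - \<phi> z0 y\<bar> \<le> L * norm (f x - z0)"
    using lipschitz_onD[OF lip[OF z(3)], of "f x" z0] by (simp add: dist_norm)
  also have "\<dots> \<le> L * (b + norm z0)"
    using pos f[OF z(2)] norm_triangle_ineq4[of "f x" z0] by (intro mult_left_mono) auto
  finally show ?thesis using base[OF z(3)] z by (simp add: truncated_loss_def)
next
  case False
  then show ?thesis using pos by (auto simp: truncated_loss_def split: prod.split)
qed

lemma truncated_loss_diff_le: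
  fixes f g :: "'x \<Rightarrow> 'z::real_normed_vector"
  assumes lip: "\<And>y. y \<in> T \<Longrightarrow> L-lipschitz_on UNIV (\<lambda>z. \<phi> z y)"
    and pos: "L \<ge> 0" "e \<ge> 0" and fg: "\<And>x. x \<in> S \<Longrightarrow> norm (f x - g x) \<le> e"
  shows "\<bar>truncated_loss \<phi> S T f z - truncated_loss \<phi> S T g z\<bar> \<le> L * e"
proof (cases "z \<in> S \<times> T")
  case True
  then obtain x y where z: "z = (x, y)" "x \<in> S" "y \<in> T" by auto
  have "\<bar>\<phi> (f x) y - \<phi> (g x) y\<bar> \<le> L * norm (f x - g x)"
    using lipschitz_onD[OF lip[OF z(3)], of "f x" "g x"] by (simp add: dist_norm)
  also have "\<dots> \<le> L * e" using pos fg[OF z(2)] by (intro mult_left_mono) auto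
  finally show ?thesis using z by (simp add: truncated_loss_def)
next
  case False
  then show ?thesis using pos by (auto simp: truncated_loss_def split: prod.split)
qed

section \<open>Empirical risk minimization over a class with a finite net\<close>

text \<open>Hoeffding's inequality for every member of the family, and a union bound.\<close>

lemma (in prob_space) finite_family_deviation:
  fixes \<xi> :: "nat \<Rightarrow> 'a \<Rightarrow> 'b" and loss :: "'i \<Rightarrow> 'b \<Rightarrow> real"
  assumes n: "n \<ge> 1" and indep: "indep_vars (\<lambda>_. N) \<xi> {1..n}"
    and Z: "Z \<in> M \<rightarrow>\<^sub>M N" and distr: "\<And>s. s \<in> {1..n} \<Longrightarrow> distr M N (\<xi> s) = distr M N Z"
    and H: "finite H" and meas: "\<And>h. h \<in> H \<Longrightarrow> loss h \<in> borel_measurable N"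
    and bound: "\<And>h z. h \<in> H \<Longrightarrow> \<bar>loss h z\<bar> \<le> B" and B: "B > 0" and t: "t \<ge> 0"
  defines "bad \<equiv> {w \<in> space M. \<exists>h\<in>H.
    (\<Sum>s=1..n. loss h (\<xi> s w)) / real n \<le> expectation (\<lambda>w. loss h (Z w)) - t}"
  shows "bad \<in> events" and "prob bad \<le> real (card H) * exp (- real n * t\<^sup>2 / (2 * B\<^sup>2))"
proof -
  define bad1 where "bad1 h = {w \<in> space M.
    (\<Sum>s=1..n. loss h (\<xi> s w)) / real n \<le> expectation (\<lambda>w. loss h (Z w)) - t}" for h
  have \<xi>: "\<xi> s \<in> M \<rightarrow>\<^sub>M N" if "s \<in> {1..n}" for s
    using indep that by (auto simp: indep_vars_def2)
  have ev: "bad1 h \<in> events" if "h \<in> H" for h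
  proof -
    have "(\<lambda>w. loss h (\<xi> s w)) \<in> borel_measurable M" if "s \<in> {1..n}" for s
      using measurable_compose[OF \<xi>[OF that] meas[OF \<open>h \<in> H\<close>]] .
    then have "(\<lambda>w. (\<Sum>s=1..n. loss h (\<xi> s w)) / real n) \<in> borel_measurable M"
      by (intro borel_measurable_divide borel_measurable_sum) auto
    then show ?thesis unfolding bad1_def by measurable
  qed
  have pr: "prob (bad1 h) \<le> exp (- real n * t\<^sup>2 / (2 * B\<^sup>2))" if h: "h \<in> H" for h
  proof -
    interpret Hoeffding_ineq_iid M "{1..n}" "\<lambda>s w. loss h (\<xi> s w)" "\<lambda>w. loss h (Z w)" "- B" B
      "expectation (\<lambda>w. loss h (Z w))"
    proof unfold_locales
      show "indep_vars (\<lambda>_. borel) (\<lambda>s w. loss h (\<xi> s w)) {1..n}"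
        using indep_vars_compose2[OF indep, of "\<lambda>_. loss h" "\<lambda>_. borel"] meas[OF h] by simp
      show "(\<lambda>w. loss h (Z w)) \<in> borel_measurable M" using measurable_compose[OF Z meas[OF h]] .
      show "AE w in M. loss h (Z w) \<in> {- B..B}" using bound[OF h] by (auto simp: abs_le_iff minus_le_iff)
      fix s assume s: "s \<in> {1..n}"
      have "distr M borel (\<lambda>w. loss h (\<xi> s w)) = distr (distr M N (\<xi> s)) borel (loss h)"
        using distr_distr[OF meas[OF h] \<xi>[OF s]] by (simp add: comp_def)
      also have "\<dots> = distr M borel (\<lambda>w. loss h (Z w))"
        unfolding distr[OF s] using distr_distr[OF meas[OF h] Z] by (simp add: comp_def)
      finally show "distr M borel (\<lambda>w. loss h (\<xi> s w)) = distr M borel (\<lambda>w. loss h (Z w))" .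
    qed auto
    have "prob (bad1 h) \<le> exp (- 2 * real n * t\<^sup>2 / (B - - B)\<^sup>2)"
      using Hoeffding_ineq_le'[OF t] B n unfolding bad1_def by simp
    also have "- 2 * real n * t\<^sup>2 / (B - - B)\<^sup>2 = - real n * t\<^sup>2 / (2 * B\<^sup>2)"
      using B by (simp add: power2_eq_square field_simps)
    finally show ?thesis .
  qed
  have bad: "bad = (\<Union>h\<in>H. bad1 h)" by (auto simp: bad_def bad1_def)
  show "bad \<in> events" unfolding bad using ev H by (intro sets.finite_UN) auto
  have "prob bad \<le> (\<Sum>h\<in>H. prob (bad1 h))"
    unfolding bad using H ev by (intro measure_UNION_le) auto
  also have "\<dots> \<le> (\<Sum>h\<in>H. exp (- real n * t\<^sup>2 / (2 * B\<^sup>2)))" by (intro sum_mono pr)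
  finally show "prob bad \<le> real (card H) * exp (- real n * t\<^sup>2 / (2 * B\<^sup>2))" by simp
qed

text \<open>For a minimizer \<open>f\<close> with nearest net point \<open>h\<close>, the chain is: risk of \<open>f\<close>, risk of
  \<open>h\<close>, empirical risk of \<open>h\<close>, empirical risk of \<open>f\<close>, empirical risk of \<open>g\<close>, risk
  of \<open>g\<close>. The first and the third transition cost \<open>e\<close> each. The second needs a deviation
  bound on the whole net, and the last one only at the comparison function \<open>g\<close>.\<close>

lemma (in prob_space) erm_excess_risk_bound:
  fixes \<xi> :: "nat \<Rightarrow> 'a \<Rightarrow> 'b" and loss :: "'i \<Rightarrow> 'b \<Rightarrow> real" and D :: nat
  assumes n: "n \<ge> 1" and indep: "indep_vars (\<lambda>_. N) \<xi> {1..n}"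
    and Z: "Z \<in> M \<rightarrow>\<^sub>M N" and distr: "\<And>s. s \<in> {1..n} \<Longrightarrow> distr M N (\<xi> s) = distr M N Z"
    and meas: "\<And>f. f \<in> A \<Longrightarrow> loss f \<in> borel_measurable N"
    and bound: "\<And>f z. f \<in> A \<Longrightarrow> \<bar>loss f z\<bar> \<le> B" and B: "B > 0"
    and H: "finite H" "H \<subseteq> A" "card H \<le> n ^ D"
    and net: "\<And>f. f \<in> A \<Longrightarrow> \<exists>h\<in>H. \<forall>z. \<bar>loss f z - loss h z\<bar> \<le> e"
    and g: "g \<in> A" and \<delta>: "0 < \<delta>" "\<delta> < 1"
  shows "\<exists>E\<in>events. prob E \<ge> 1 - \<delta> \<and> (\<forall>w\<in>E. \<forall>f\<in>A.
    (\<Sum>s=1..n. loss f (\<xi> s w)) \<le> (\<Sum>s=1..n. loss g (\<xi> s w)) \<longrightarrow>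
    expectation (\<lambda>w. loss f (Z w)) \<le> expectation (\<lambda>w. loss g (Z w)) + 2 * e
      + sqrt 2 * B * sqrt (real D * ln (real n) / real n) + 2 * sqrt 2 * B * sqrt (ln (2 / \<delta>) / real n))"
proof -
  define u where "u = ln (2 / \<delta>)"
  have u: "u > 0" using \<delta> by (simp add: u_def)
  have n0: "real n > 0" using n by simp
  define v where "v = real D * ln (real n)"
  have v: "v \<ge> 0" using n by (simp add: v_def)
  \<comment> \<open>The levels make the failure probabilities \<open>\<delta> / 2\<close> each: \<open>exp (- v)\<close> is the reciprocal
    of the bound for the size of the net, and \<open>exp (- u) = \<delta> / 2\<close>.\<close>
  define t where "t = B * sqrt (2 * (v + u) / real n)"
  define t' where "t' = B * sqrt (2 * u / real n)"
  have t: "t \<ge> 0" "t' \<ge> 0" using B u v by (auto simp: t_def t'_def)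
  have sq: "- real n * t\<^sup>2 / (2 * B\<^sup>2) = - (v + u)" "- real n * t'\<^sup>2 / (2 * B\<^sup>2) = - u"
    using B u v n0 by (simp_all add: t_def t'_def power_mult_distrib del: distrib_left_numeral)
  have exp_u: "exp (- u) = \<delta> / 2" using \<delta> by (simp add: u_def ln_div exp_diff)
  have exp_v: "exp (- v) = 1 / real n ^ D"
    using n0 by (simp add: v_def exp_minus inverse_eq_divide exp_of_nat_mult)
  define bad where "bad = {w \<in> space M. \<exists>h\<in>H.
    (\<Sum>s=1..n. loss h (\<xi> s w)) / real n \<le> expectation (\<lambda>w. loss h (Z w)) - t}"
  define bad' where "bad' = {w \<in> space M. \<exists>h\<in>{g}.
    (\<Sum>s=1..n. - loss h (\<xi> s w)) / real n \<le> expectation (\<lambda>w. - loss h (Z w)) - t'}"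
  have ev: "bad \<in> events" and "prob bad \<le> real (card H) * exp (- (v + u))"
    using finite_family_deviation[OF n indep Z distr H(1), of loss B t] meas bound H(2) B t(1)
    unfolding bad_def sq by auto
  note \<open>prob bad \<le> real (card H) * exp (- (v + u))\<close>
  also have "real (card H) * exp (- (v + u)) = (real (card H) / real n ^ D) * (\<delta> / 2)"
  proof -
    have "exp (- (v + u)) = exp (- v) * exp (- u)" by (simp flip: exp_add)
    then show ?thesis by (simp add: exp_u exp_v)
  qed
  also have "\<dots> \<le> 1 * (\<delta> / 2)"
  proof (intro mult_right_mono)
    have "real (card H) \<le> real n ^ D" using H(3) by (metis of_nat_le_iff of_nat_power)
    then show "real (card H) / real n ^ D \<le> 1" using n0 by simp
  qed (use \<delta> in auto)
  finally have pr: "prob bad \<le> \<delta> / 2" by simp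
  have "(\<lambda>z. - loss h z) \<in> borel_measurable N" "\<bar>- loss h z\<bar> \<le> B" if "h \<in> {g}" for h z
    using meas[OF g] bound[OF g] that by simp_all
  note dev' = finite_family_deviation[where loss="\<lambda>h z. - loss h z" and H="{g}",
      OF n indep Z distr _ this B t(2), folded bad'_def, unfolded sq]
  have ev': "bad' \<in> events" by (rule dev'(1)) simp_all
  have "prob bad' \<le> real (card {g}) * exp (- u)" by (rule dev'(2)) simp_all
  then have pr': "prob bad' \<le> \<delta> / 2" by (simp add: exp_u)
  have "prob (bad \<union> bad') \<le> \<delta>" using measure_Un_le[OF ev ev'] pr pr' by linarith
  then have prE: "prob (space M - (bad \<union> bad')) \<ge> 1 - \<delta>"
    using ev ev' by (subst prob_compl) auto
  have int: "integrable M (\<lambda>w. loss f (Z w))" if "f \<in> A" for f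
    using measurable_compose[OF Z meas[OF that]] bound[OF that]
    by (intro integrable_const_bound[of _ B]) auto
  have "expectation (\<lambda>w. loss f (Z w)) \<le> expectation (\<lambda>w. loss g (Z w)) + 2 * e
      + sqrt 2 * B * sqrt (real D * ln (real n) / real n) + 2 * sqrt 2 * B * sqrt (ln (2 / \<delta>) / real n)"
    if w: "w \<in> space M - (bad \<union> bad')" and f: "f \<in> A"
      and le: "(\<Sum>s=1..n. loss f (\<xi> s w)) \<le> (\<Sum>s=1..n. loss g (\<xi> s w))" for w f
  proof -
    obtain h where h: "h \<in> H" "\<And>z. \<bar>loss f z - loss h z\<bar> \<le> e" using net[OF f] by blast
    have "expectation (\<lambda>w. loss f (Z w)) \<le> expectation (\<lambda>w. loss h (Z w) + e)"
    proof (rule integral_mono[OF int[OF f]])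
      show "integrable M (\<lambda>w. loss h (Z w) + e)" using int h(1) H(2) by auto
      show "loss f (Z w) \<le> loss h (Z w) + e" for w using h(2)[of "Z w"] by linarith
    qed
    also have "\<dots> = expectation (\<lambda>w. loss h (Z w)) + e"
      using int[of h] h(1) H(2) by (subst Bochner_Integration.integral_add) (auto simp: prob_space)
    finally have 1: "expectation (\<lambda>w. loss f (Z w)) \<le> expectation (\<lambda>w. loss h (Z w)) + e" .
    have 2: "expectation (\<lambda>w. loss h (Z w)) \<le> (\<Sum>s=1..n. loss h (\<xi> s w)) / real n + t"
      using w h(1) by (auto simp: bad_def not_le less_imp_le)
    have "(\<Sum>s=1..n. loss h (\<xi> s w)) \<le> (\<Sum>s=1..n. loss f (\<xi> s w) + e)"
    proof (rule sum_mono)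
      show "loss h (\<xi> s w) \<le> loss f (\<xi> s w) + e" for s using h(2)[of "\<xi> s w"] by linarith
    qed
    also have "\<dots> = (\<Sum>s=1..n. loss f (\<xi> s w)) + real n * e" by (simp add: sum.distrib)
    also have "\<dots> \<le> (\<Sum>s=1..n. loss g (\<xi> s w)) + real n * e" using le by simp
    finally have "(\<Sum>s=1..n. loss h (\<xi> s w)) / real n \<le> ((\<Sum>s=1..n. loss g (\<xi> s w)) + real n * e) / real n"
      using n0 by (intro divide_right_mono) auto
    then have 3: "(\<Sum>s=1..n. loss h (\<xi> s w)) / real n \<le> (\<Sum>s=1..n. loss g (\<xi> s w)) / real n + e"
      using n0 by (simp add: add_divide_distrib)
    have 4: "(\<Sum>s=1..n. loss g (\<xi> s w)) / real n \<le> expectation (\<lambda>w. loss g (Z w)) + t'"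
      using w by (auto simp: bad'_def not_le sum_negf)
    have "sqrt (2 * (v + u) / real n) = sqrt 2 * sqrt (v / real n + u / real n)"
      by (simp add: real_sqrt_mult[symmetric] add_divide_distrib)
    also have "\<dots> \<le> sqrt 2 * (sqrt (v / real n) + sqrt (u / real n))"
      using u v by (intro mult_left_mono sqrt_add_le_add_sqrt) auto
    finally have "t \<le> B * (sqrt 2 * (sqrt (v / real n) + sqrt (u / real n)))"
      unfolding t_def using B by (intro mult_left_mono) auto
    moreover have "t' = B * (sqrt 2 * sqrt (u / real n))"
      by (simp add: t'_def real_sqrt_mult[symmetric])
    ultimately have "t + t' \<le> sqrt 2 * B * sqrt (v / real n) + 2 * sqrt 2 * B * sqrt (u / real n)"
      by (simp add: algebra_simps)
    with 1 2 3 4 show ?thesis unfolding u_def v_def by linarith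
  qed
  then show ?thesis using prE ev ev' by (intro bexI[of _ "space M - (bad \<union> bad')"]) auto
qed

section \<open>The risk bound\<close>

text \<open>The sharper constants that the net argument yields, compared with the closed form of the
  statistical error.\<close>

lemma estimation_terms_le:
  fixes d K p n :: nat and \<mu> L r B :: real
  assumes "\<mu> \<ge> 0" "L \<ge> 0" "r \<ge> 0" "B \<ge> 0" "n \<ge> 1" "K \<ge> 1"
  shows "2 * (L * (2 * sqrt d * (\<mu> / n) * (p * r + 1)))
      \<le> 16 * \<mu> * L * sqrt (2 * d * K * (p + 1) * (p * r\<^sup>2 + 1)) / n"
    and "sqrt 2 * B * sqrt (real (2 * d * K * (p + 1)) * ln n / n)
      \<le> 4 * B * sqrt (2 * d * K * (p + 1) * ln n / n)"
proof -
  let ?s = "sqrt (2 * d * K * (p + 1) * (p * r\<^sup>2 + 1))"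
  \<comment> \<open>This is the Cauchy--Schwarz inequality for the vectors \<open>(r, \<dots>, r, 1)\<close> and \<open>(1, \<dots>, 1)\<close>.\<close>
  have "0 \<le> real p * (r - 1)\<^sup>2" by simp
  then have "(p * r + 1)\<^sup>2 \<le> (p + 1) * (p * r\<^sup>2 + 1)"
    by (simp add: power2_eq_square algebra_simps)
  then have "d * (p * r + 1)\<^sup>2 \<le> d * ((p + 1) * (p * r\<^sup>2 + 1))"
    by (intro mult_left_mono) auto
  also have "\<dots> \<le> (2 * K) * (d * ((p + 1) * (p * r\<^sup>2 + 1)))"
  proof -
    have "1 * (d * ((p + 1) * (p * r\<^sup>2 + 1))) \<le> (2 * real K) * (d * ((p + 1) * (p * r\<^sup>2 + 1)))"
      using assms by (intro mult_right_mono) auto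
    then show ?thesis by simp
  qed
  also have "\<dots> = 2 * d * K * (p + 1) * (p * r\<^sup>2 + 1)"
    by (simp only: of_nat_mult of_nat_add of_nat_1 of_nat_numeral mult_ac)
  finally have "sqrt (d * (p * r + 1)\<^sup>2) \<le> ?s" by (rule real_sqrt_le_mono)
  then have s: "sqrt d * (p * r + 1) \<le> ?s" using assms by (simp add: real_sqrt_mult)
  have "2 * (L * (2 * sqrt d * (\<mu> / n) * (p * r + 1))) = (4 * \<mu> * L / n) * (sqrt d * (p * r + 1))"
    by simp
  also have "\<dots> \<le> (16 * \<mu> * L / n) * ?s"
    using assms s by (intro mult_mono divide_right_mono mult_right_mono) auto
  finally show "2 * (L * (2 * sqrt d * (\<mu> / n) * (p * r + 1))) \<le> 16 * \<mu> * L * ?s / n" by simp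
  have "sqrt 2 \<le> sqrt 16" by (intro real_sqrt_le_mono) simp
  then have "sqrt 2 \<le> (4::real)" by simp
  then show "sqrt 2 * B * sqrt (real (2 * d * K * (p + 1)) * ln n / n)
      \<le> 4 * B * sqrt (2 * d * K * (p + 1) * ln n / n)"
    using assms by (intro mult_mono) (auto simp: mult_ac)
qed

theorem theorem1:
  fixes M :: "'w measure"
    and X :: "'w \<Rightarrow> real^'p"
    and Y :: "'w \<Rightarrow> 'y::second_countable_topology"
    and \<xi> :: "nat \<Rightarrow> 'w \<Rightarrow> (real^'p) \<times> 'y"
    and \<phi> :: "real^'d \<Rightarrow> 'y \<Rightarrow> real"
    and fstar :: "real^'p \<Rightarrow> real^'d"
    and z0 :: "real^'d"
    and XX :: "(real^'p) set" and YY :: "'y set"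
    and n K p d :: nat
    and Xbar L\<^sub>\<phi> C\<^sub>\<phi> L\<^sub>z M\<^sub>z \<mu> Mpd \<delta> :: real
  assumes p: "p = CARD('p)" and d: "d = CARD('d)"
    and n: "n \<ge> 1" and K: "K \<ge> 1"
    and \<delta>: "0 < \<delta>" "\<delta> < 1"
    and M: "prob_space M"
    and X: "X \<in> M \<rightarrow>\<^sub>M borel" and XX: "XX = rv_support M X"
    and Y: "Y \<in> M \<rightarrow>\<^sub>M borel" and YY: "YY = rv_support M Y"
    and \<phi>_measurable:
      "(\<lambda>(z, y). \<phi> z y) \<in> borel \<Otimes>\<^sub>M restrict_space borel YY \<rightarrow>\<^sub>M borel"
    and independent: "prob_space.indep_vars M (\<lambda>_. borel \<Otimes>\<^sub>M borel) \<xi> {1..n}"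
    and identically_distributed: "\<And>s. s \<in> {1..n} \<Longrightarrow>
      distr M (borel \<Otimes>\<^sub>M borel) (\<xi> s) = distr M (borel \<Otimes>\<^sub>M borel) (\<lambda>w. (X w, Y w))"
    and XX_compact: "compact XX"
    and Xbar: "Xbar \<in> infnorm ` XX" "\<And>x. x \<in> XX \<Longrightarrow> infnorm x \<le> Xbar"
    and L\<^sub>\<phi>: "L\<^sub>\<phi> > 0" and C\<^sub>\<phi>: "C\<^sub>\<phi> > 0"
    and \<phi>_lipschitz: "\<And>y. y \<in> YY \<Longrightarrow> L\<^sub>\<phi>-lipschitz_on UNIV (\<lambda>z. \<phi> z y)"
    and \<phi>_bound: "\<And>y. y \<in> YY \<Longrightarrow> \<bar>\<phi> z0 y\<bar> \<le> C\<^sub>\<phi>"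
    and fstar_minimizer: "is_arg_min (risk \<phi> M X Y) (\<lambda>f. f \<in> predictors XX) fstar"
    and L\<^sub>z: "L\<^sub>z > 0" and M\<^sub>z: "M\<^sub>z > 0"
    and fstar_lipschitz: "fstar \<in> lipschitz_class XX L\<^sub>z M\<^sub>z"
    and \<mu>: "\<mu> \<ge> max (1/2 * L\<^sub>z * real K powr (1 / p))
                     (1/4 * p * L\<^sub>z * Xbar * real K powr (1 / p) + 1/2 * M\<^sub>z)"
    and Mpd: "Mpd = C\<^sub>\<phi> + L\<^sub>\<phi> * (2 * sqrt d * \<mu> * (p * Xbar + 1) + norm z0)"
  shows "\<exists>E \<in> sets M. measure M E \<ge> 1 - \<delta> \<and>
    (\<forall>w\<in>E. \<forall>fhat :: real^'p \<Rightarrow> real^'d.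
       is_arg_min (empirical_risk \<phi> n (\<lambda>s. \<xi> s w)) (\<lambda>f. f \<in> dc_class K \<mu>) fhat \<longrightarrow>
       risk \<phi> M X Y fhat \<le> (INF f\<in>predictors XX. risk \<phi> M X Y f) +
         ereal (2 * sqrt d * (sqrt p + 3) * sqrt p * L\<^sub>\<phi> * L\<^sub>z * Xbar * real K powr (- 1 / p)
           + 16 * \<mu> * L\<^sub>\<phi> * sqrt (2 * d * K * (p + 1) * (p * Xbar\<^sup>2 + 1)) / n
           + 4 * Mpd * sqrt (2 * d * K * (p + 1) * ln n / n)
           + 2 * sqrt 2 * Mpd * sqrt (ln (2 / \<delta>) / n)))"
proof -
  interpret prob_space M by (rule M)
  let ?N = "borel \<Otimes>\<^sub>M borel :: ((real^'p) \<times> 'y) measure"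
  let ?Z = "\<lambda>w. (X w, Y w)"
  define loss where "loss f = truncated_loss \<phi> XX YY f" for f :: "real^'p \<Rightarrow> real^'d"
  have closed: "closed XX" "closed YY" unfolding XX YY by (rule closed_rv_support)+
  then have XXYY: "XX \<in> sets borel" "YY \<in> sets borel" by auto
  then have S: "XX \<times> YY \<in> sets ?N" by (rule pair_measureI)
  have Z: "?Z \<in> M \<rightarrow>\<^sub>M ?N" using X Y by (rule measurable_Pair)
  have AE_Z: "AE w in M. ?Z w \<in> XX \<times> YY"
    using AE_in_rv_support[of X M] AE_in_rv_support[of Y M] unfolding XX YY by eventually_elim auto
  have \<xi>_meas: "\<xi> s \<in> M \<rightarrow>\<^sub>M ?N" if "s \<in> {1..n}" for s
    using independent that by (auto simp: indep_vars_def2)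
  have AE_\<xi>: "AE w in M. \<xi> s w \<in> XX \<times> YY" if "s \<in> {1..n}" for s
  proof -
    have S': "{z \<in> space ?N. z \<in> XX \<times> YY} \<in> sets ?N" using S by (simp add: space_pair_measure)
    have "AE z in distr M ?N ?Z. z \<in> XX \<times> YY" using AE_Z by (subst AE_distr_iff[OF Z S'])
    then have "AE z in distr M ?N (\<xi> s). z \<in> XX \<times> YY"
      unfolding identically_distributed[OF that] .
    then show ?thesis by (subst (asm) AE_distr_iff[OF \<xi>_meas[OF that] S'])
  qed
  have XX_ne: "XX \<noteq> {}" and Xbar0: "Xbar \<ge> 0" using Xbar(1) infnorm_pos_le by auto
  have Kp: "real K powr (1 / p) > 0" using K by simp
  have \<mu>1: "\<mu> \<ge> 1/2 * L\<^sub>z * real K powr (1 / real CARD('p))"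
    "\<mu> \<ge> 1/4 * real CARD('p) * L\<^sub>z * Xbar * real K powr (1 / real CARD('p)) + 1/2 * M\<^sub>z"
    using \<mu> by (auto simp: p)
  have "1/2 * L\<^sub>z * real K powr (1 / p) > 0" using L\<^sub>z Kp by simp
  with \<mu> have \<mu>0: "\<mu> > 0" by linarith
  define b where "b = 2 * sqrt d * \<mu> * (p * Xbar + 1)"
  have b0: "b \<ge> 0" using \<mu>0 Xbar0 by (simp add: b_def)
  have Mpd_eq: "Mpd = C\<^sub>\<phi> + L\<^sub>\<phi> * (b + norm z0)" by (simp add: Mpd b_def)
  have Mpd0: "Mpd > 0" unfolding Mpd_eq using C\<^sub>\<phi> L\<^sub>\<phi> b0 by (intro add_pos_nonneg) auto
  define A :: "(real^'p \<Rightarrow> real^'d) set" where "A = dc_class K \<mu>"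
  have A_pred: "f \<in> predictors XX" if "f \<in> A" for f
    using dc_class_measurable[of f K \<mu>] that unfolding A_def predictors_def
    by (auto intro: measurable_restrict_space1)
  have A_norm: "norm (f x) \<le> b" if "f \<in> A" "x \<in> XX" for f x
    using dc_class_norm_le[of f K \<mu> x Xbar] that K Xbar(2)
    unfolding A_def b_def p d by (simp only: mult_ac)
  have loss_meas: "loss f \<in> borel_measurable ?N" if "f \<in> predictors XX" for f
    unfolding loss_def by (rule truncated_loss_measurable[OF XXYY that \<phi>_measurable])
  have loss_bound: "\<bar>loss f z\<bar> \<le> C\<^sub>\<phi> + L\<^sub>\<phi> * (c + norm z0)"
    if "c \<ge> 0" "\<And>x. x \<in> XX \<Longrightarrow> norm (f x) \<le> c" for f z c
    unfolding loss_def using that C\<^sub>\<phi> L\<^sub>\<phi>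
    by (intro truncated_loss_bounded[OF \<phi>_lipschitz \<phi>_bound]) auto
  have loss_A: "\<bar>loss f z\<bar> \<le> Mpd" if "f \<in> A" for f z
    unfolding Mpd_eq using loss_bound[OF b0 A_norm[OF that]] .
  have int: "integrable M (\<lambda>w. loss f (?Z w))"
    if "f \<in> predictors XX" "c \<ge> 0" "\<And>x. x \<in> XX \<Longrightarrow> norm (f x) \<le> c" for f c
    using measurable_compose[OF Z loss_meas[OF that(1)]] loss_bound[OF that(2,3)]
    by (intro integrable_const_bound[of _ "C\<^sub>\<phi> + L\<^sub>\<phi> * (c + norm z0)"]) auto
  have risk_eq: "risk \<phi> M X Y f = ereal (expectation (\<lambda>w. loss f (?Z w)))"
    if "integrable M (\<lambda>w. loss f (?Z w))" for f
    unfolding risk_def using that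
  proof (rule ext_expectation_eq_integral)
    show "AE w in M. \<phi> (f (X w)) (Y w) = loss f (?Z w)"
      using AE_Z by eventually_elim (simp add: loss_def truncated_loss_def)
  qed
  have int_A: "integrable M (\<lambda>w. loss f (?Z w))" if "f \<in> A" for f
    using int[OF A_pred[OF that] b0 A_norm[OF that]] .

  define \<epsilon> where "\<epsilon> = sqrt d * (2 * (sqrt p + 3) * sqrt p * L\<^sub>z * Xbar * real K powr (- 1 / p))"
  have \<epsilon>0: "\<epsilon> \<ge> 0" using L\<^sub>z Xbar0 by (simp add: \<epsilon>_def)
  obtain g where g: "g \<in> A" "\<And>x. x \<in> XX \<Longrightarrow> norm (g x - fstar x) \<le> \<epsilon>"
    using dc_class_approximates_lipschitz[OF XX_ne Xbar(2) L\<^sub>z fstar_lipschitz K \<mu>1]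
    unfolding A_def \<epsilon>_def p d by auto
  have fstar_pred: "fstar \<in> predictors XX" using fstar_minimizer by (simp add: is_arg_min_def)
  \<comment> \<open>Any finite bound will do here, for integrability; the constant \<open>Mpd\<close> concerns the class only.\<close>
  have fstar_norm: "norm (fstar x) \<le> b + \<epsilon>" if "x \<in> XX" for x
    using g(2)[OF that] A_norm[OF g(1) that] norm_triangle_ineq2[of "fstar x" "g x"]
    by (simp add: norm_minus_commute)
  have int_star: "integrable M (\<lambda>w. loss fstar (?Z w))"
    using int[OF fstar_pred _ fstar_norm] b0 \<epsilon>0 by simp
  have approx: "expectation (\<lambda>w. loss g (?Z w)) \<le> expectation (\<lambda>w. loss fstar (?Z w)) + L\<^sub>\<phi> * \<epsilon>"
  proof -
    have diff: "\<bar>loss g z - loss fstar z\<bar> \<le> L\<^sub>\<phi> * \<epsilon>" for z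
      unfolding loss_def using L\<^sub>\<phi> \<epsilon>0 g(2) by (intro truncated_loss_diff_le[OF \<phi>_lipschitz]) auto
    have "expectation (\<lambda>w. loss g (?Z w)) \<le> expectation (\<lambda>w. loss fstar (?Z w) + L\<^sub>\<phi> * \<epsilon>)"
    proof (rule integral_mono[OF int_A[OF g(1)]])
      show "integrable M (\<lambda>w. loss fstar (?Z w) + L\<^sub>\<phi> * \<epsilon>)" using int_star by auto
      show "loss g (?Z w) \<le> loss fstar (?Z w) + L\<^sub>\<phi> * \<epsilon>" for w using diff[of "?Z w"] by linarith
    qed
    also have "\<dots> = expectation (\<lambda>w. loss fstar (?Z w)) + L\<^sub>\<phi> * \<epsilon>"
      using int_star by (subst Bochner_Integration.integral_add) (auto simp: prob_space)
    finally show ?thesis .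
  qed

  define e where "e = L\<^sub>\<phi> * (2 * sqrt d * (\<mu> / n) * (p * Xbar + 1))"
  obtain H :: "(real^'p \<Rightarrow> real^'d) set" where H: "finite H" "H \<subseteq> A"
    "card H \<le> n ^ (2 * d * K * (p + 1))"
    "\<And>f. f \<in> A \<Longrightarrow> \<exists>h\<in>H. \<forall>x. \<forall>r::real. infnorm x \<le> r \<longrightarrow>
      norm (f x - h x) \<le> 2 * sqrt d * (\<mu> / n) * (p * r + 1)"
    using dc_class_finite_net[OF K n less_imp_le[OF \<mu>0], where 'p='p and 'd='d]
    unfolding A_def p d by metis
  have net: "\<exists>h\<in>H. \<forall>z. \<bar>loss f z - loss h z\<bar> \<le> e" if fA: "f \<in> A" for f
  proof -
    obtain h where h: "h \<in> H" "\<And>x. infnorm x \<le> Xbar \<Longrightarrow>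
        norm (f x - h x) \<le> 2 * sqrt d * (\<mu> / n) * (p * Xbar + 1)"
      using H(4)[OF fA] by blast
    have "\<bar>loss f z - loss h z\<bar> \<le> e" for z
      unfolding loss_def e_def using L\<^sub>\<phi> \<mu>0 Xbar0 h(2) Xbar(2)
      by (intro truncated_loss_diff_le[OF \<phi>_lipschitz]) auto
    with h(1) show ?thesis by blast
  qed
  let ?excess = "2 * e + sqrt 2 * Mpd * sqrt (real (2 * d * K * (p + 1)) * ln (real n) / real n)
    + 2 * sqrt 2 * Mpd * sqrt (ln (2 / \<delta>) / real n)"
  obtain E where E: "E \<in> events" "prob E \<ge> 1 - \<delta>"
    "\<And>w f. w \<in> E \<Longrightarrow> f \<in> A \<Longrightarrow> (\<Sum>s=1..n. loss f (\<xi> s w)) \<le> (\<Sum>s=1..n. loss g (\<xi> s w)) \<Longrightarrow>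
      expectation (\<lambda>w. loss f (?Z w)) \<le> expectation (\<lambda>w. loss g (?Z w)) + ?excess"
    using erm_excess_risk_bound[where loss=loss and A=A, OF n independent Z identically_distributed
        loss_meas[OF A_pred] loss_A Mpd0 H(1-3) net g(1) \<delta>]
    by (auto simp: add.assoc)
  \<comment> \<open>Only samples inside the supports have the same empirical risk for the truncated loss as for
    the original one.\<close>
  define E' where "E' = {w \<in> E. \<forall>s\<in>{1..n}. \<xi> s w \<in> XX \<times> YY}"
  have E'_meas: "E' \<in> events"
  proof -
    have "E' = E \<inter> (\<Inter>s\<in>{1..n}. \<xi> s -` (XX \<times> YY) \<inter> space M)"
      using n sets.sets_into_space[OF E(1)] by (auto simp: E'_def)
    also have "\<dots> \<in> events"
      using n by (intro sets.Int E(1) sets.finite_INT measurable_sets[OF \<xi>_meas S]) auto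
    finally show ?thesis .
  qed
  have "prob E' = prob E"
  proof (rule measure_eq_AE[OF _ E'_meas E(1)])
    have "AE w in M. \<forall>s\<in>{1..n}. \<xi> s w \<in> XX \<times> YY" using AE_\<xi> by (intro AE_finite_allI) auto
    then show "AE w in M. (w \<in> E') = (w \<in> E)" by eventually_elim (auto simp: E'_def)
  qed
  moreover have "risk \<phi> M X Y fhat \<le> (INF f\<in>predictors XX. risk \<phi> M X Y f) +
         ereal (2 * sqrt d * (sqrt p + 3) * sqrt p * L\<^sub>\<phi> * L\<^sub>z * Xbar * real K powr (- 1 / p)
           + 16 * \<mu> * L\<^sub>\<phi> * sqrt (2 * d * K * (p + 1) * (p * Xbar\<^sup>2 + 1)) / n
           + 4 * Mpd * sqrt (2 * d * K * (p + 1) * ln n / n)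
           + 2 * sqrt 2 * Mpd * sqrt (ln (2 / \<delta>) / n))" (is "_ \<le> _ + ereal ?bound")
    if w: "w \<in> E'" and fhat: "is_arg_min (empirical_risk \<phi> n (\<lambda>s. \<xi> s w)) (\<lambda>f. f \<in> dc_class K \<mu>) fhat"
    for w and fhat :: "real^'p \<Rightarrow> real^'d"
  proof -
    have fhat_A: "fhat \<in> A" using fhat by (simp add: is_arg_min_def A_def)
    have emp: "empirical_risk \<phi> n (\<lambda>s. \<xi> s w) f = 1 / real n * (\<Sum>s=1..n. loss f (\<xi> s w))" for f
    proof -
      have "\<phi> (f (fst (\<xi> s w))) (snd (\<xi> s w)) = loss f (\<xi> s w)" if "s \<in> {1..n}" for s
      proof -
        have "\<xi> s w \<in> XX \<times> YY" using w that by (simp add: E'_def)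
        then show ?thesis by (auto simp: loss_def truncated_loss_def)
      qed
      then show ?thesis unfolding empirical_risk_def by simp
    qed
    have "empirical_risk \<phi> n (\<lambda>s. \<xi> s w) fhat \<le> empirical_risk \<phi> n (\<lambda>s. \<xi> s w) g"
      using fhat g(1) by (auto simp: is_arg_min_linorder A_def)
    then have "(\<Sum>s=1..n. loss fhat (\<xi> s w)) \<le> (\<Sum>s=1..n. loss g (\<xi> s w))"
      unfolding emp using n by (simp add: divide_le_cancel)
    with w have "expectation (\<lambda>w. loss fhat (?Z w)) \<le> expectation (\<lambda>w. loss g (?Z w)) + ?excess"
      by (intro E(3) fhat_A) (auto simp: E'_def)
    also have "\<dots> \<le> expectation (\<lambda>w. loss fstar (?Z w)) + L\<^sub>\<phi> * \<epsilon> + ?excess" using approx by simp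
    also have "\<dots> \<le> expectation (\<lambda>w. loss fstar (?Z w)) + ?bound"
    proof -
      note est = estimation_terms_le[of \<mu> L\<^sub>\<phi> Xbar Mpd n K d p]
      have "L\<^sub>\<phi> * \<epsilon> = 2 * sqrt d * (sqrt p + 3) * sqrt p * L\<^sub>\<phi> * L\<^sub>z * Xbar * real K powr (- 1 / p)"
        by (simp add: \<epsilon>_def mult_ac)
      moreover have "2 * e \<le> 16 * \<mu> * L\<^sub>\<phi> * sqrt (2 * d * K * (p + 1) * (p * Xbar\<^sup>2 + 1)) / n"
        unfolding e_def using est(1) \<mu>0 L\<^sub>\<phi> Xbar0 Mpd0 n K by simp
      moreover have "sqrt 2 * Mpd * sqrt (real (2 * d * K * (p + 1)) * ln (real n) / real n)
          \<le> 4 * Mpd * sqrt (2 * d * K * (p + 1) * ln n / n)"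
        using est(2) \<mu>0 L\<^sub>\<phi> Xbar0 Mpd0 n K by simp
      ultimately show ?thesis by linarith
    qed
    finally have "risk \<phi> M X Y fhat \<le> risk \<phi> M X Y fstar + ereal ?bound"
      unfolding risk_eq[OF int_A[OF fhat_A]] risk_eq[OF int_star] by simp
    also have "risk \<phi> M X Y fstar \<le> (INF f\<in>predictors XX. risk \<phi> M X Y f)"
      using fstar_minimizer by (auto simp: is_arg_min_linorder intro!: INF_greatest)
    finally show ?thesis by (simp add: add_right_mono)
  qed
  ultimately show ?thesis using E(2) E'_meas by (intro bexI[of _ E']) auto
qed

end
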